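(* Let $n$ be an odd positive integer. Among the $2^{n+3}$ assignments of over/under data to the crossings of the free $2\ 1\ n$ knot, the number that produce the trefoil is $$8\binom{n}{\frac{n-3}{2}}+2\binom{n}{\frac{n-1}{2}}+2\binom{n}{\frac{n-5}{2}},$$ and, in general, for $k$-foils with $k\le n$, the number that produce the $k$-foil is $$8\binom{n}{\frac{n-k}{2}}+2\binom{n}{\frac{n-k+2}{2}}+2\binom{n}{\frac{n-k-2}{2}}.$$
   Context: Binomial coefficients with negative lower index are $0$. Knots are not distinguished from their mirror images. For odd $n$, the free $2\ 1\ n$ knot is the following planar closed curve with $n+3$ double points (the free closure of Conway's $2\ 1\ n$ tangle). Take a horizontal row of $n$ crossings: two parallel horizontal strands crossing each other $n$ times in succession, with four ends (upper-left, lower-left, upper-right, lower-right). Above the row place three further crossings $L$ (left), $R$ (right, at the same height as $L$) and $B$ (centered, below $L$ and $R$), each drawn as an $\mathsf{X}$ with ends NW, NE, SW, SE. Join, without further crossings: NE of $L$ to NW of $R$ by an inner arc; NW of $L$ to NE of $R$ by an outer arc passing above the inner one; SE of $L$ to NW of $B$; SW of $R$ to NE of $B$; SW of $B$ to the upper-left end of the row; SE of $B$ to the upper-right end of the row; SW of $L$ to the lower-left end of the row (around the left side); SE of $R$ to the lower-right end of the row (around the right side). An assignment is a choice, at each crossing, of which of the two strands is the overstrand; it produces a knot diagram. For an odd positive integer $k$, the $k$-foil is the knot obtained by twisting two horizontal strands $k$ times in the same direction and then joining the two upper ends to each other and the two lower ends to each other (the $(2,k)$ torus knot); the $1$-foil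 is the unknot and the $3$-foil is the trefoil.
   Formalization: The general formula is stated for odd k with 3 ≤ k ≤ n; the case k = 1 (the unknot) is left out because the formula is false there: for n = 1 it gives 10, but 12 of the 16 assignments produce the unknot. *)

theory Defs
  imports Complex_Main "HOL-Library.FuncSet"
begin

text \<open>
  Plane diagrams of knots are given in Morse form: the plane is swept from left to right by a
  vertical line, and the diagram is the list of the events met on the way. At every moment the
  strands met by the line are numbered 0, 1, 2, ... from top to bottom. The events at position
  \<open>i\<close> are:

  \<^item> \<open>(Opening, i)\<close>: an arc with a vertical tangent is born; its two ends become strands
    \<open>i\<close> (upper) and \<open>i + 1\<close> (lower);
  \<^item> \<open>(Closing, i)\<close>: strands \<open>i\<close> and \<open>i + 1\<close> are joined by an arc and disappear;
  \<^item> \<open>(Crossing c, i)\<close>: strands \<open>i\<close> and \<open>i + 1\<close> cross each other. The ends of this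
    crossing are: NW and SW on the left (strands \<open>i\<close> and \<open>i + 1\<close> before the event),
    NE and SE on the right (strands \<open>i\<close> and \<open>i + 1\<close> after the event).

  In a free diagram (no over/under data) the label \<open>c\<close> is the name of the crossing. In a knot
  diagram it is a boolean: \<open>True\<close> if the strand from NW to SE is the overstrand, \<open>False\<close> if
  the strand from SW to NE is.
\<close>

datatype 'c event = Opening | Closing | Crossing 'c

type_synonym 'c free_diagram = "('c event \<times> nat) list"
type_synonym diagram = "bool free_diagram"

fun width_in :: "'c event \<Rightarrow> nat" where
  "width_in Opening = 0"
| "width_in Closing = 2"
| "width_in (Crossing c) = 2"

fun width_out :: "'c event \<Rightarrow> nat" where
  "width_out Opening = 2"
| "width_out Closing = 0"
| "width_out (Crossing c) = 2"

text \<open>\<open>wf_from m D\<close>: started on \<open>m\<close> strands, every event of \<open>D\<close> finds the strands it acts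
  on, and no strand is left at the end.\<close>

fun wf_from :: "nat \<Rightarrow> 'c free_diagram \<Rightarrow> bool" where
  "wf_from m [] \<longleftrightarrow> m = 0"
| "wf_from m ((e, i) # D) \<longleftrightarrow>
     i + width_in e \<le> m \<and> wf_from (m - width_in e + width_out e) D"

definition closed_diagram :: "'c free_diagram \<Rightarrow> bool" where
  "closed_diagram D \<longleftrightarrow> wf_from 0 D"

text \<open>
  The local moves that generate ambient isotopy of (unoriented) diagrams in Morse form. The first
  five are the planar isotopies: exchange of two events that take place on disjoint
  sets of adjacent strands (the event \<open>e\<close> lies above \<open>f\<close>), cancellation of a zigzag, and
  a strand sliding over or under the turning point of an arc. The others are the three Reidemeister
  moves. In \<open>R3\<close> the first crossing is between the strands 1 and 2 (counted from the top
  on the left), the second one between 1 and 3, the third one between 2 and 3; the side condition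
  says that strand 1 or strand 3 lies entirely over or entirely under the other two, which
  excludes exactly the two cyclic patterns to which the move does not apply.
\<close>

inductive local_move :: "diagram \<Rightarrow> diagram \<Rightarrow> bool" where
  exchange: "i + width_in e \<le> j \<Longrightarrow>
     local_move [(f, j), (e, i)] [(e, i), (f, j + width_out e - width_in e)]"
| zigzag_down: "local_move [(Opening, i), (Closing, Suc i)] []"
| zigzag_up: "local_move [(Opening, Suc i), (Closing, i)] []"
| slide_opening: "local_move [(Opening, i), (Crossing b, Suc i)] [(Opening, Suc i), (Crossing (\<not> b), i)]"
| slide_closing: "local_move [(Crossing b, Suc i), (Closing, i)] [(Crossing (\<not> b), i), (Closing, Suc i)]"
| R1_opening: "local_move [(Opening, i), (Crossing b, i)] [(Opening, i)]"
| R1_closing: "local_move [(Crossing b, i), (Closing, i)] [(Closing, i)]"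
| R2: "local_move [(Crossing b, i), (Crossing (\<not> b), i)] []"
| R3: "a = b \<or> b = c \<Longrightarrow>
     local_move [(Crossing a, i), (Crossing b, Suc i), (Crossing c, i)]
                [(Crossing c, Suc i), (Crossing b, i), (Crossing a, Suc i)]"

definition move :: "diagram \<Rightarrow> diagram \<Rightarrow> bool" where
  "move D E \<longleftrightarrow> closed_diagram D \<and> closed_diagram E \<and>
     (\<exists>u v x y. local_move x y \<and> D = u @ x @ v \<and> E = u @ y @ v)"

definition isotopic :: "diagram \<Rightarrow> diagram \<Rightarrow> bool" where
  "isotopic = equivclp move"

definition assign :: "('c \<Rightarrow> bool) \<Rightarrow> 'c free_diagram \<Rightarrow> diagram" where
  "assign s F = map (map_prod (map_event s) id) F"

definition mirror :: "diagram \<Rightarrow> diagram" where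
  "mirror D = assign Not D"

definition same_knot :: "diagram \<Rightarrow> diagram \<Rightarrow> bool" where
  "same_knot D E \<longleftrightarrow> isotopic D E \<or> isotopic D (mirror E)"

definition crossings :: "'c free_diagram \<Rightarrow> 'c set" where
  "crossings F = {c. \<exists>i. (Crossing c, i) \<in> set F}"

definition assignments :: "'c free_diagram \<Rightarrow> ('c \<Rightarrow> bool) set" where
  "assignments F = (crossings F \<rightarrow>\<^sub>E (UNIV :: bool set))"

text \<open>Strands 1 and 2 are the two that are twisted; strands 0 and 3 are the arcs that join the
  upper ends, passing above the twists, and the lower ends, passing below them.\<close>

definition foil :: "nat \<Rightarrow> diagram" where
  "foil k = [(Opening, 0), (Opening, 2)] @ replicate k (Crossing True, 1)
     @ [(Closing, 0), (Closing, 0)]"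

datatype crossing_name = L | R | B | Row nat

text \<open>
  The strands met by the sweeping line, from top to bottom, after each event:

  \<^item> \<open>(Opening, 0)\<close>: outer arc, NW of L
  \<^item> \<open>(Opening, 2)\<close>: outer arc, NW of L, SW of L, lower-left end of the row
  \<^item> \<open>(Crossing L, 1)\<close>: outer arc, inner arc (NE of L), SE of L, lower-left end of the row
  \<^item> \<open>(Opening, 3)\<close>: outer arc, inner arc, SE of L (= NW of B), SW of B, upper-left end of the
    row, lower-left end of the row
  \<^item> \<open>(Crossing B, 2)\<close>: outer arc, inner arc, NE of B, SE of B, the two left ends of the row
  \<^item> the row: outer arc, inner arc, NE of B, SE of B, the two right ends of the row
  \<^item> \<open>(Closing, 3)\<close>: outer arc, inner arc (= NW of R), NE of B (= SW of R), lower-right end of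
    the row
  \<^item> \<open>(Crossing R, 1)\<close>: outer arc, NE of R, SE of R, lower-right end of the row
  \<^item> \<open>(Closing, 0)\<close>: SE of R, lower-right end of the row
  \<^item> \<open>(Closing, 0)\<close>: nothing
\<close>

definition free_21n :: "nat \<Rightarrow> crossing_name free_diagram" where
  "free_21n n =
     [(Opening, 0), (Opening, 2), (Crossing L, 1), (Opening, 3), (Crossing B, 2)]
     @ map (\<lambda>j. (Crossing (Row j), 4)) [0..<n]
     @ [(Closing, 3), (Crossing R, 1), (Closing, 0), (Closing, 0)]"

definition num_producing :: "nat \<Rightarrow> diagram \<Rightarrow> nat" where
  "num_producing n K = card {s \<in> assignments (free_21n n). same_knot (assign s (free_21n n)) K}"

text \<open>The binomial coefficient, extended by 0 to negative lower indices.\<close>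

definition binom :: "nat \<Rightarrow> int \<Rightarrow> nat" where
  "binom n j = (if j < 0 then 0 else n choose nat j)"

lemma wf_from_twists:
  assumes "i + 2 \<le> m"
  shows "\<forall>x\<in>set xs. \<exists>c. x = (Crossing c, i) \<Longrightarrow> wf_from m (xs @ D) = wf_from m D"
proof (induction xs)
  case (Cons x xs)
  moreover obtain c where "x = (Crossing c, i)"
    using Cons.prems by auto
  moreover have "m - 2 + 2 = m"
    using assms by simp
  ultimately show ?case
    using assms by (simp del: add_2_eq_Suc')
qed simp

lemma closed_diagram_foil: "closed_diagram (foil k)"
  by (simp add: closed_diagram_def foil_def wf_from_twists[of 1] ex_bool_eq)

lemma closed_diagram_assign: "closed_diagram (assign s F) \<longleftrightarrow> closed_diagram F"
proof -
  have width: "width_in (map_event s e) = width_in e" "width_out (map_event s e) = width_out e" for e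
    by (cases e; simp)+
  have "wf_from m (map (map_prod (map_event s) id) F) = wf_from m F" for m
    by (induction m F rule: wf_from.induct) (simp_all add: width)
  then show ?thesis
    by (simp add: closed_diagram_def assign_def)
qed

lemma closed_diagram_free_21n: "closed_diagram (free_21n n)"
  by (simp add: closed_diagram_def free_21n_def wf_from_twists[of 4])

lemma card_assignments_free_21n: "card (assignments (free_21n n)) = 2 ^ (n + 3)"
proof -
  have "crossings (free_21n n) = {L, R, B} \<union> Row ` {0..<n}"
    by (auto simp: crossings_def free_21n_def)
  moreover have "card ({L, R, B} \<union> Row ` {0..<n}) = n + 3"
    by (subst card_Un_disjoint) (auto simp: card_image inj_on_def)
  ultimately show ?thesis
    by (simp add: assignments_def card_PiE)
qed

end

theory Submission
  imports Defs
begin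

text \<open>
  If L and R carry opposite labels, the clasp comes apart and then B can be untwisted, which leaves the
  closed row. If L, R and B agree, a third Reidemeister move turns the clasp into two further
  crossings of the row. In these cases the knot is the \<open>\<bar>w\<bar>\<close>-foil, respectively the
  \<open>\<bar>w \<plusminus> 2\<bar>\<close>-foil, where \<open>w\<close> is the signed number of crossings of the row. In the remaining
  case, with B opposite to L and R, the knot is never a \<open>k\<close>-foil with \<open>k \<ge> 3\<close>. This, and the fact
  that different foils are different knots, is detected by the Kauffman bracket at \<open>A = 2\<close>: up to sign
  and powers of 2 it is an odd integer, and these integers are distinguished by residues modulo
  powers of 2 and by size. The binomial coefficients count the rows with a given signed number
  of crossings.
\<close>

subsection \<open>Isotopy of tangles\<close>

text \<open>A version of \<open>wf_from\<close> with any number of strands at the end, so that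
  pieces of a diagram can be typed and composed.\<close>

fun tangle :: "nat \<Rightarrow> 'c free_diagram \<Rightarrow> nat \<Rightarrow> bool" where
  "tangle m [] n \<longleftrightarrow> m = n"
| "tangle m ((e, i) # D) n \<longleftrightarrow>
     i + width_in e \<le> m \<and> tangle (m - width_in e + width_out e) D n"

lemma tangle_event [simp]:
  "tangle m ((Opening, i) # D) n \<longleftrightarrow> i \<le> m \<and> tangle (m + 2) D n"
  "tangle m ((Closing, i) # D) n \<longleftrightarrow> i + 2 \<le> m \<and> tangle (m - 2) D n"
  "tangle m ((Crossing c, i) # D) n \<longleftrightarrow> i + 2 \<le> m \<and> tangle m D n"
  by (auto simp: le_add_diff_inverse2 simp del: add_2_eq_Suc' cong: conj_cong)

lemma tangle_append: "tangle m (D @ E) n \<longleftrightarrow> (\<exists>k. tangle m D k \<and> tangle k E n)"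
  by (induction m D n rule: tangle.induct) auto

lemma tangle_target_unique: "tangle m D n \<Longrightarrow> tangle m D n' \<Longrightarrow> n = n'"
  by (induction m D n rule: tangle.induct) auto

text \<open>The bound in \<open>tangle\<close> keeps the subtraction from being truncated, so the
  number of strands can also be traced backwards.\<close>

lemma tangle_source_unique: "tangle m D n \<Longrightarrow> tangle m' D n \<Longrightarrow> m = m'"
  by (induction m D n arbitrary: m' rule: tangle.induct) fastforce+

declare tangle.simps(2) [simp del]

lemma closed_diagram_iff_tangle: "closed_diagram D \<longleftrightarrow> tangle 0 D 0"
proof -
  have "wf_from m D \<longleftrightarrow> tangle m D 0" for m
    by (induction m D rule: wf_from.induct) (auto simp: tangle.simps(2))
  then show ?thesis
    by (simp add: closed_diagram_def)
qed

definition tangle_move :: "nat \<Rightarrow> nat \<Rightarrow> diagram \<Rightarrow> diagram \<Rightarrow> bool" where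
  "tangle_move m n D E \<longleftrightarrow> tangle m D n \<and> tangle m E n \<and>
     (\<exists>u v x y. local_move x y \<and> D = u @ x @ v \<and> E = u @ y @ v)"

definition tangle_iso :: "nat \<Rightarrow> nat \<Rightarrow> diagram \<Rightarrow> diagram \<Rightarrow> bool" where
  "tangle_iso m n = equivclp (tangle_move m n)"

lemma isotopic_eq_tangle_iso: "isotopic = tangle_iso 0 0"
proof -
  have "move = tangle_move 0 0"
    by (intro ext) (simp add: move_def tangle_move_def closed_diagram_iff_tangle)
  then show ?thesis
    by (simp add: isotopic_def tangle_iso_def)
qed

lemma tangle_iso_refl [simp]: "tangle_iso m n D D"
  by (simp add: tangle_iso_def)

lemma tangle_iso_sym: "tangle_iso m n D E \<Longrightarrow> tangle_iso m n E D"
  by (simp add: tangle_iso_def equivclp_sym)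

lemma tangle_iso_trans [trans]:
  "tangle_iso m n D E \<Longrightarrow> tangle_iso m n E F \<Longrightarrow> tangle_iso m n D F"
  by (auto simp: tangle_iso_def intro: equivclp_trans)

text \<open>A move already takes place inside some context, and a further context is absorbed into
  it, move by move.\<close>

lemma tangle_iso_context:
  assumes "tangle_iso m n x y" "tangle k u m" "tangle n v l"
  shows "tangle_iso k l (u @ x @ v) (u @ y @ v)"
  using assms(1) unfolding tangle_iso_def
proof (induction rule: equivclp_induct)
  case (step y z)
  have "tangle_move k l (u @ a @ v) (u @ b @ v)" if ab: "tangle_move m n a b" for a b
  proof -
    obtain u' v' x' y' where *: "local_move x' y'" "a = u' @ x' @ v'" "b = u' @ y' @ v'"
      using ab by (auto simp: tangle_move_def)
    have "tangle k (u @ a @ v) l" "tangle k (u @ b @ v) l"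
      using ab assms(2,3) unfolding tangle_append tangle_move_def by blast+
    moreover have "u @ a @ v = (u @ u') @ x' @ v' @ v" "u @ b @ v = (u @ u') @ y' @ v' @ v"
      using * by simp_all
    ultimately show ?thesis
      using *(1) unfolding tangle_move_def by blast
  qed
  then show ?case
    using step by (meson equivclp_into_equivclp)
qed simp

lemma tangle_iso_contextI:
  assumes "tangle_iso m n x y" "D = u @ x @ v" "E = u @ y @ v" "tangle k u m" "tangle n v l"
  shows "tangle_iso k l D E"
  using tangle_iso_context[OF assms(1,4,5)] assms(2,3) by simp

lemma tangle_iso_moveI:
  assumes "local_move x y" "D = u @ x @ v" "E = u @ y @ v" "tangle m D n" "tangle m E n"
  shows "tangle_iso m n D E"
  using assms unfolding tangle_iso_def tangle_move_def by (blast intro: r_into_equivclp)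

lemmas tangle_iso_moveI' = tangle_iso_moveI [THEN tangle_iso_sym]

section \<open>Rows of crossings at a fixed position\<close>

definition twists :: "nat \<Rightarrow> bool list \<Rightarrow> diagram" where
  "twists i cs = map (\<lambda>c. (Crossing c, i)) cs"

lemma twists_simps [simp]:
  "twists i [] = []"
  "twists i (c # cs) = (Crossing c, i) # twists i cs"
  by (simp_all add: twists_def)

lemma tangle_twists [simp]:
  "i + 2 \<le> m \<Longrightarrow> tangle m (twists i cs @ D) n \<longleftrightarrow> tangle m D n"
  "i + 2 \<le> m \<Longrightarrow> tangle m (twists i cs) n \<longleftrightarrow> m = n"
  by (induction cs) auto

text \<open>An event above the row passes its crossings one at a time; the row shifts by the change
  in the number of strands above it.\<close>

lemma twists_exchange:
  assumes "i + width_in e \<le> j" "j + 2 \<le> m" "j' = j + width_out e - width_in e"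
    "n = m + width_out e - width_in e"
  shows "tangle_iso m n (twists j cs @ [(e, i)]) ((e, i) # twists j' cs)"
proof (induction cs)
  case (Cons c cs)
  have "tangle_iso m n ([(Crossing c, j)] @ (twists j cs @ [(e, i)]) @ [])
      ([(Crossing c, j)] @ ((e, i) # twists j' cs) @ [])"
    using assms by (intro tangle_iso_context[OF Cons.IH]) auto
  also have "[(Crossing c, j)] @ ((e, i) # twists j' cs) @ [] =
      [] @ [(Crossing c, j), (e, i)] @ twists j' cs"
    by simp
  also have "tangle_iso m n \<dots> ([] @ [(e, i), (Crossing c, j')] @ twists j' cs)"
  proof (rule tangle_iso_moveI)
    show "local_move [(Crossing c, j), (e, i)] [(e, i), (Crossing c, j')]"
      using local_move.exchange[of i e j "Crossing c"] assms by simp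
  qed (rule refl, rule refl, (use assms in \<open>cases e; auto\<close>)+)
  finally show ?case
    by simp
qed (cases e; use assms in auto)

lemma twists_exchangeI:
  assumes "D = u @ twists j cs @ (e, i) # v" "E = u @ (e, i) # twists (j + width_out e - width_in e) cs @ v"
    "tangle k u m" "tangle (m + width_out e - width_in e) v l" "i + width_in e \<le> j" "j + 2 \<le> m"
  shows "tangle_iso k l D E"
  using tangle_iso_context[OF twists_exchange[OF assms(5,6) refl refl, of cs] assms(3,4)] assms(1,2)
  by simp

lemmas twists_exchangeI' = twists_exchangeI [THEN tangle_iso_sym]

abbreviation "Op i \<equiv> (Opening, i)"
abbreviation "Cl i \<equiv> (Closing, i)"
abbreviation "Cr c i \<equiv> (Crossing c, i)"

subsection \<open>Simplifying the diagrams\<close>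

text \<open>Three crossings \<open>False\<close> at 2, 1, 0 carry the bottom strand over the other
  three to the top. The arc can instead be born beneath this strand, after the latter has crossed
  the one remaining strand.\<close>

lemma over_pass_Opening:
  "tangle_iso 2 4 [Op 0, Cr False 2, Cr False 1, Cr False 0]
     [Cr False 0, Op 1]"
proof -
  have "tangle_iso 2 4 [Op 0, Cr False 2, Cr False 1, Cr False 0]
      [Cr False 0, Op 0, Cr False 1, Cr False 0]"
    by (rule tangle_iso_moveI'[OF exchange[of 0 Opening 0 "Crossing False", simplified],
          of _ "[]" "[Cr False 1, Cr False 0]"]) simp_all
  also have "tangle_iso 2 4 \<dots>
      [Cr False 0, Op 1, Cr True 0, Cr False 0]"
    by (rule tangle_iso_moveI[OF slide_opening[of 0 False, simplified],
          of _ "[Cr False 0]" "[Cr False 0]"]) simp_all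
  also have "tangle_iso 2 4 \<dots>
      [Cr False 0, Op 1]"
    by (rule tangle_iso_moveI[OF R2[of True 0, simplified],
          of _ "[Cr False 0, Op 1]" "[]"]) simp_all
  finally show ?thesis .
qed

lemma over_pass_Closing:
  "tangle_iso 4 2 [Cr False 2, Cr False 1, Cr False 0, Cl 1]
     [Cl 0, Cr False 0]"
proof -
  have "tangle_iso 4 2 [Cr False 2, Cr False 1, Cr False 0, Cl 1]
      [Cr False 2, Cr False 1, Cr True 1, Cl 0]"
    by (rule tangle_iso_moveI'[OF slide_closing[of True 0, simplified],
          of _ "[Cr False 2, Cr False 1]" "[]"]) simp_all
  also have "tangle_iso 4 2 \<dots>
      [Cr False 2, Cl 0]"
    by (rule tangle_iso_moveI[OF R2[of False 1, simplified],
          of _ "[Cr False 2]" "[Cl 0]"]) simp_all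
  also have "tangle_iso 4 2 \<dots>
      [Cl 0, Cr False 0]"
    by (rule tangle_iso_moveI[OF exchange[of 0 Closing 2 "Crossing False", simplified],
          of _ "[]" "[]"]) simp_all
  finally show ?thesis .
qed

text \<open>\<open>R3\<close> applies for either label \<open>c\<close>, because the passing strand
  is over at both of its crossings in the triple.\<close>

lemma over_pass_Crossing: "tangle_iso 4 4 [Cr False 2, Cr False 1, Cr False 0, Cr c 2]
    [Cr c 1, Cr False 2, Cr False 1, Cr False 0]"
proof -
  have "tangle_iso 4 4 [Cr False 2, Cr False 1, Cr False 0, Cr c 2]
      [Cr False 2, Cr False 1, Cr c 2, Cr False 0]"
    by (rule tangle_iso_moveI'[OF exchange[of 0 "Crossing False" 2 "Crossing c", simplified],
          of _ "[Cr False 2, Cr False 1]" "[]"]) simp_all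
  also have "tangle_iso 4 4 \<dots>
      [Cr c 1, Cr False 2, Cr False 1, Cr False 0]"
    by (rule tangle_iso_moveI'[OF R3[of c False False 1, simplified],
          of _ "[]" "[Cr False 0]"]) simp_all
  finally show ?thesis .
qed

text \<open>\<open>L\<close> and \<open>R\<close> are moved until they are adjacent and cancel by
  \<open>R2\<close>; \<open>B\<close> then becomes a curl, which \<open>R1\<close> removes. The row
  is left with both closing arcs passing above it.\<close>

lemma unclasp:
  "tangle_iso 0 0 ([Op 0, Op 2, Cr l 1, Op 3, Cr b 2] @ twists 4 cs @ [Cl 3, Cr (\<not> l) 1, Cl 0, Cl 0])
     ([Op 0, Op 1] @ twists 2 cs @ [Cl 1, Cl 0])"
proof -
  have "tangle_iso 0 0 ([Op 0, Op 2, Cr l 1, Op 3, Cr b 2] @ twists 4 cs @ [Cl 3, Cr (\<not> l) 1, Cl 0, Cl 0])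
      ([Op 0, Op 0, Cr l 1, Op 3, Cr b 2] @ twists 4 cs @ [Cl 3, Cr (\<not> l) 1, Cl 0, Cl 0])"
    by (rule tangle_iso_moveI'[OF exchange[of 0 Opening 0 Opening, simplified],
          of _ "[]" "[Cr l 1, Op 3, Cr b 2] @ twists 4 cs @ [Cl 3, Cr (\<not> l) 1, Cl 0, Cl 0]"]) simp_all
  \<comment> \<open>\<open>slide_opening\<close> and \<open>slide_closing\<close> turn
    \<open>L\<close> and \<open>R\<close> into crossings of the two uppermost strands, with flipped
    labels; no event between them then acts on these strands.\<close>
  also have "tangle_iso 0 0 \<dots>
      ([Op 0, Op 1, Cr (\<not> l) 0, Op 3, Cr b 2] @ twists 4 cs @ [Cl 3, Cr (\<not> l) 1, Cl 0, Cl 0])"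
    by (rule tangle_iso_moveI[OF slide_opening[of 0 l, simplified],
          of _ "[Op 0]" "[Op 3, Cr b 2] @ twists 4 cs @ [Cl 3, Cr (\<not> l) 1, Cl 0, Cl 0]"]) simp_all
  also have "tangle_iso 0 0 \<dots>
      ([Op 0, Op 1, Cr (\<not> l) 0, Op 3, Cr b 2] @ twists 4 cs @ [Cl 3, Cr l 0, Cl 1, Cl 0])"
    by (rule tangle_iso_moveI[OF slide_closing[of "\<not> l" 0, simplified],
          of _ "[Op 0, Op 1, Cr (\<not> l) 0, Op 3, Cr b 2] @ twists 4 cs @ [Cl 3]" "[Cl 0]"]) simp_all
  also have "tangle_iso 0 0 \<dots>
      ([Op 0, Op 1, Cr (\<not> l) 0, Op 3, Cr b 2] @ twists 4 cs @ [Cr l 0, Cl 3, Cl 1, Cl 0])"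
    by (rule tangle_iso_moveI[OF exchange[of 0 "Crossing l" 3 Closing, simplified],
          of _ "[Op 0, Op 1, Cr (\<not> l) 0, Op 3, Cr b 2] @ twists 4 cs" "[Cl 1, Cl 0]"]) simp_all
  also have "tangle_iso 0 0 \<dots>
      ([Op 0, Op 1, Cr (\<not> l) 0, Op 3, Cr b 2, Cr l 0] @ twists 4 cs @ [Cl 3, Cl 1, Cl 0])"
    by (rule twists_exchangeI
          [of _ "[Op 0, Op 1, Cr (\<not> l) 0, Op 3, Cr b 2]" 4 cs "Crossing l" 0 "[Cl 3, Cl 1, Cl 0]" _ _ 6]) simp_all
  also have "tangle_iso 0 0 \<dots>
      ([Op 0, Op 1, Cr (\<not> l) 0, Op 3, Cr l 0, Cr b 2] @ twists 4 cs @ [Cl 3, Cl 1, Cl 0])"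
    by (rule tangle_iso_moveI[OF exchange[of 0 "Crossing l" 2 "Crossing b", simplified],
          of _ "[Op 0, Op 1, Cr (\<not> l) 0, Op 3]" "twists 4 cs @ [Cl 3, Cl 1, Cl 0]"]) simp_all
  also have "tangle_iso 0 0 \<dots>
      ([Op 0, Op 1, Cr (\<not> l) 0, Cr l 0, Op 3, Cr b 2] @ twists 4 cs @ [Cl 3, Cl 1, Cl 0])"
    by (rule tangle_iso_moveI[OF exchange[of 0 "Crossing l" 3 Opening, simplified],
          of _ "[Op 0, Op 1, Cr (\<not> l) 0]" "[Cr b 2] @ twists 4 cs @ [Cl 3, Cl 1, Cl 0]"]) simp_all
  also have "tangle_iso 0 0 \<dots>
      ([Op 0, Op 1, Op 3, Cr b 2] @ twists 4 cs @ [Cl 3, Cl 1, Cl 0])"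
    by (rule tangle_iso_moveI[OF R2[of "\<not> l" 0, simplified],
          of _ "[Op 0, Op 1]" "[Op 3, Cr b 2] @ twists 4 cs @ [Cl 3, Cl 1, Cl 0]"]) simp_all
  also have "tangle_iso 0 0 \<dots>
      ([Op 0, Op 1, Op 3, Cr b 2] @ twists 4 cs @ [Cl 1, Cl 1, Cl 0])"
    by (rule tangle_iso_moveI[OF exchange[of 1 Closing 3 Closing, simplified],
          of _ "[Op 0, Op 1, Op 3, Cr b 2] @ twists 4 cs" "[Cl 0]"]) simp_all
  also have "tangle_iso 0 0 \<dots>
      ([Op 0, Op 1, Op 3, Cr b 2, Cl 1] @ twists 2 cs @ [Cl 1, Cl 0])"
    by (rule twists_exchangeI
          [of _ "[Op 0, Op 1, Op 3, Cr b 2]" 4 cs Closing 1 "[Cl 1, Cl 0]" _ _ 6]) simp_all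
  \<comment> \<open>Slid over the turning point, \<open>B\<close> becomes a crossing between the two
    ends of one arc, that is, a curl.\<close>
  also have "tangle_iso 0 0 \<dots>
      ([Op 0, Op 1, Op 3, Cr (\<not> b) 1, Cl 2] @ twists 2 cs @ [Cl 1, Cl 0])"
    by (rule tangle_iso_moveI[OF slide_closing[of b 1, simplified],
          of _ "[Op 0, Op 1, Op 3]" "twists 2 cs @ [Cl 1, Cl 0]"]) simp_all
  also have "tangle_iso 0 0 \<dots>
      ([Op 0, Op 1, Cr (\<not> b) 1, Op 3, Cl 2] @ twists 2 cs @ [Cl 1, Cl 0])"
    by (rule tangle_iso_moveI[OF exchange[of 1 "Crossing (\<not> b)" 3 Opening, simplified],
          of _ "[Op 0, Op 1]" "[Cl 2] @ twists 2 cs @ [Cl 1, Cl 0]"]) simp_all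
  also have "tangle_iso 0 0 \<dots>
      ([Op 0, Op 1, Op 3, Cl 2] @ twists 2 cs @ [Cl 1, Cl 0])"
    by (rule tangle_iso_moveI[OF R1_opening[of 1 "\<not> b", simplified],
          of _ "[Op 0]" "[Op 3, Cl 2] @ twists 2 cs @ [Cl 1, Cl 0]"]) simp_all
  also have "tangle_iso 0 0 \<dots>
      ([Op 0, Op 1] @ twists 2 cs @ [Cl 1, Cl 0])"
    by (rule tangle_iso_moveI[OF zigzag_up[of 2, simplified],
          of _ "[Op 0, Op 1]" "twists 2 cs @ [Cl 1, Cl 0]"]) simp_all
  finally show ?thesis .
qed

text \<open>When the three upper crossings have the same label, the third Reidemeister move applies. One of
  the resulting crossings is nugatory, and the two others can be carried around into the row.\<close>

lemma clasp_reduction: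
  "tangle_iso 0 0 ([Op 0, Op 2, Cr b 1, Op 3, Cr b 2] @ twists 4 cs @ [Cl 3, Cr b 1, Cl 0, Cl 0])
     ([Op 0, Op 1, Cr b 2, Cr b 2] @ twists 2 cs @ [Cl 1, Cl 0])"
proof -
  have "tangle_iso 0 0 ([Op 0, Op 2, Cr b 1, Op 3, Cr b 2] @ twists 4 cs @ [Cl 3, Cr b 1, Cl 0, Cl 0])
      ([Op 0, Op 2, Cr b 1, Op 3, Cr b 2] @ twists 4 cs @ [Cr b 1, Cl 3, Cl 0, Cl 0])"
    by (rule tangle_iso_moveI[OF exchange[of 1 "Crossing b" 3 Closing, simplified],
          of _ "[Op 0, Op 2, Cr b 1, Op 3, Cr b 2] @ twists 4 cs" "[Cl 0, Cl 0]"]) simp_all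
  also have "tangle_iso 0 0 \<dots>
      ([Op 0, Op 2, Cr b 1, Op 3, Cr b 2, Cr b 1] @ twists 4 cs @ [Cl 3, Cl 0, Cl 0])"
    by (rule twists_exchangeI
          [of _ "[Op 0, Op 2, Cr b 1, Op 3, Cr b 2]" 4 cs "Crossing b" 1 "[Cl 3, Cl 0, Cl 0]" _ _ 6]) simp_all
  also have "tangle_iso 0 0 \<dots>
      ([Op 0, Op 2, Op 3, Cr b 1, Cr b 2, Cr b 1] @ twists 4 cs @ [Cl 3, Cl 0, Cl 0])"
    by (rule tangle_iso_moveI'[OF exchange[of 1 "Crossing b" 3 Opening, simplified],
          of _ "[Op 0, Op 2]" "[Cr b 2, Cr b 1] @ twists 4 cs @ [Cl 3, Cl 0, Cl 0]"]) simp_all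
  \<comment> \<open>The crossings at 1, 2, 1 are \<open>L\<close>, \<open>B\<close> and
    \<open>R\<close>; their equal labels give the side condition of \<open>R3\<close>.\<close>
  also have "tangle_iso 0 0 \<dots>
      ([Op 0, Op 2, Op 3, Cr b 2, Cr b 1, Cr b 2] @ twists 4 cs @ [Cl 3, Cl 0, Cl 0])"
    by (rule tangle_iso_moveI[OF R3[of b b b 1, simplified],
          of _ "[Op 0, Op 2, Op 3]" "twists 4 cs @ [Cl 3, Cl 0, Cl 0]"]) simp_all
  also have "tangle_iso 0 0 \<dots>
      ([Op 0, Op 2, Op 3, Cr b 2, Cr b 1] @ twists 4 cs @ [Cr b 2, Cl 3, Cl 0, Cl 0])"
    by (rule twists_exchangeI'
          [of _ "[Op 0, Op 2, Op 3, Cr b 2, Cr b 1]" 4 cs "Crossing b" 2 "[Cl 3, Cl 0, Cl 0]" _ _ 6]) simp_all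
  \<comment> \<open>The first and the last crossing of the triple at 2, 1, 2 become crossings at 3
    on either side of the row, which frees the middle one.\<close>
  also have "tangle_iso 0 0 \<dots>
      ([Op 0, Op 2, Op 3, Cr b 2, Cr b 1] @ twists 4 cs @ [Cr (\<not> b) 3, Cl 2, Cl 0, Cl 0])"
    by (rule tangle_iso_moveI'[OF slide_closing[of "\<not> b" 2, simplified],
          of _ "[Op 0, Op 2, Op 3, Cr b 2, Cr b 1] @ twists 4 cs" "[Cl 0, Cl 0]"]) simp_all
  also have "tangle_iso 0 0 \<dots>
      ([Op 0, Op 2, Op 2, Cr (\<not> b) 3, Cr b 1] @ twists 4 cs @ [Cr (\<not> b) 3, Cl 2, Cl 0, Cl 0])"
    by (rule tangle_iso_moveI'[OF slide_opening[of 2 "\<not> b", simplified],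
          of _ "[Op 0, Op 2]" "[Cr b 1] @ twists 4 cs @ [Cr (\<not> b) 3, Cl 2, Cl 0, Cl 0]"]) simp_all
  also have "tangle_iso 0 0 \<dots>
      ([Op 0, Op 2, Op 2, Cr b 1, Cr (\<not> b) 3] @ twists 4 cs @ [Cr (\<not> b) 3, Cl 2, Cl 0, Cl 0])"
    by (rule tangle_iso_moveI[OF exchange[of 1 "Crossing b" 3 "Crossing (\<not> b)", simplified],
          of _ "[Op 0, Op 2, Op 2]" "twists 4 cs @ [Cr (\<not> b) 3, Cl 2, Cl 0, Cl 0]"]) simp_all
  also have "tangle_iso 0 0 \<dots>
      ([Op 0, Op 2, Op 4, Cr b 1, Cr (\<not> b) 3] @ twists 4 cs @ [Cr (\<not> b) 3, Cl 2, Cl 0, Cl 0])"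
    by (rule tangle_iso_moveI[OF exchange[of 2 Opening 2 Opening, simplified],
          of _ "[Op 0]" "[Cr b 1, Cr (\<not> b) 3] @ twists 4 cs @ [Cr (\<not> b) 3, Cl 2, Cl 0, Cl 0]"]) simp_all
  also have "tangle_iso 0 0 \<dots>
      ([Op 0, Op 0, Op 4, Cr b 1, Cr (\<not> b) 3] @ twists 4 cs @ [Cr (\<not> b) 3, Cl 2, Cl 0, Cl 0])"
    by (rule tangle_iso_moveI'[OF exchange[of 0 Opening 0 Opening, simplified],
          of _ "[]" "[Op 4, Cr b 1, Cr (\<not> b) 3] @ twists 4 cs @ [Cr (\<not> b) 3, Cl 2, Cl 0, Cl 0]"]) simp_all
  also have "tangle_iso 0 0 \<dots>
      ([Op 0, Op 0, Cr b 1, Op 4, Cr (\<not> b) 3] @ twists 4 cs @ [Cr (\<not> b) 3, Cl 2, Cl 0, Cl 0])"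
    by (rule tangle_iso_moveI[OF exchange[of 1 "Crossing b" 4 Opening, simplified],
          of _ "[Op 0, Op 0]" "[Cr (\<not> b) 3] @ twists 4 cs @ [Cr (\<not> b) 3, Cl 2, Cl 0, Cl 0]"]) simp_all
  also have "tangle_iso 0 0 \<dots>
      ([Op 0, Op 1, Cr (\<not> b) 0, Op 4, Cr (\<not> b) 3] @ twists 4 cs @ [Cr (\<not> b) 3, Cl 2, Cl 0, Cl 0])"
    by (rule tangle_iso_moveI[OF slide_opening[of 0 b, simplified],
          of _ "[Op 0]" "[Op 4, Cr (\<not> b) 3] @ twists 4 cs @ [Cr (\<not> b) 3, Cl 2, Cl 0, Cl 0]"]) simp_all
  also have "tangle_iso 0 0 \<dots>
      ([Op 0, Op 1, Cr (\<not> b) 0, Op 4, Cr (\<not> b) 3] @ twists 4 cs @ [Cr (\<not> b) 3, Cl 0, Cl 0, Cl 0])"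
    by (rule tangle_iso_moveI[OF exchange[of 0 Closing 2 Closing, simplified],
          of _ "[Op 0, Op 1, Cr (\<not> b) 0, Op 4, Cr (\<not> b) 3] @ twists 4 cs @ [Cr (\<not> b) 3]" "[Cl 0]"]) simp_all
  also have "tangle_iso 0 0 \<dots>
      ([Op 0, Op 1, Cr (\<not> b) 0, Op 4, Cr (\<not> b) 3] @ twists 4 cs @ [Cl 0, Cr (\<not> b) 1, Cl 0, Cl 0])"
    by (rule tangle_iso_moveI[OF exchange[of 0 Closing 3 "Crossing (\<not> b)", simplified],
          of _ "[Op 0, Op 1, Cr (\<not> b) 0, Op 4, Cr (\<not> b) 3] @ twists 4 cs" "[Cl 0, Cl 0]"]) simp_all
  also have "tangle_iso 0 0 \<dots>
      ([Op 0, Op 1, Cr (\<not> b) 0, Op 4, Cr (\<not> b) 3, Cl 0] @ twists 2 cs @ [Cr (\<not> b) 1, Cl 0, Cl 0])"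
    by (rule twists_exchangeI
          [of _ "[Op 0, Op 1, Cr (\<not> b) 0, Op 4, Cr (\<not> b) 3]" 4 cs Closing 0 "[Cr (\<not> b) 1, Cl 0, Cl 0]" _ _ 6]) simp_all
  also have "tangle_iso 0 0 \<dots>
      ([Op 0, Op 1, Cr (\<not> b) 0, Op 4, Cl 0, Cr (\<not> b) 1] @ twists 2 cs @ [Cr (\<not> b) 1, Cl 0, Cl 0])"
    by (rule tangle_iso_moveI[OF exchange[of 0 Closing 3 "Crossing (\<not> b)", simplified],
          of _ "[Op 0, Op 1, Cr (\<not> b) 0, Op 4]" "twists 2 cs @ [Cr (\<not> b) 1, Cl 0, Cl 0]"]) simp_all
  also have "tangle_iso 0 0 \<dots>
      ([Op 0, Op 1, Cr (\<not> b) 0, Cl 0, Op 2, Cr (\<not> b) 1] @ twists 2 cs @ [Cr (\<not> b) 1, Cl 0, Cl 0])"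
    by (rule tangle_iso_moveI[OF exchange[of 0 Closing 4 Opening, simplified],
          of _ "[Op 0, Op 1, Cr (\<not> b) 0]" "[Cr (\<not> b) 1] @ twists 2 cs @ [Cr (\<not> b) 1, Cl 0, Cl 0]"]) simp_all
  \<comment> \<open>The nugatory crossing has become a curl next to a closing arc.\<close>
  also have "tangle_iso 0 0 \<dots>
      ([Op 0, Op 1, Cl 0, Op 2, Cr (\<not> b) 1] @ twists 2 cs @ [Cr (\<not> b) 1, Cl 0, Cl 0])"
    by (rule tangle_iso_moveI[OF R1_closing[of "\<not> b" 0, simplified],
          of _ "[Op 0, Op 1]" "[Op 2, Cr (\<not> b) 1] @ twists 2 cs @ [Cr (\<not> b) 1, Cl 0, Cl 0]"]) simp_all
  also have "tangle_iso 0 0 \<dots>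
      ([Op 0, Op 2, Cr (\<not> b) 1] @ twists 2 cs @ [Cr (\<not> b) 1, Cl 0, Cl 0])"
    by (rule tangle_iso_moveI[OF zigzag_up[of 0, simplified],
          of _ "[Op 0]" "[Op 2, Cr (\<not> b) 1] @ twists 2 cs @ [Cr (\<not> b) 1, Cl 0, Cl 0]"]) simp_all
  \<comment> \<open>The left crossing enters the row directly. The right one is moved onto the two
    upper strands, carried above the row to the left side and slid down into the row. Both end with
    label \<open>b\<close>.\<close>
  also have "tangle_iso 0 0 \<dots>
      ([Op 0, Op 1, Cr b 2] @ twists 2 cs @ [Cr (\<not> b) 1, Cl 0, Cl 0])"
    by (rule tangle_iso_moveI'[OF slide_opening[of 1 b, simplified],
          of _ "[Op 0]" "twists 2 cs @ [Cr (\<not> b) 1, Cl 0, Cl 0]"]) simp_all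
  also have "tangle_iso 0 0 \<dots>
      ([Op 0, Op 1, Cr b 2] @ twists 2 cs @ [Cr b 0, Cl 1, Cl 0])"
    by (rule tangle_iso_moveI[OF slide_closing[of "\<not> b" 0, simplified],
          of _ "[Op 0, Op 1, Cr b 2] @ twists 2 cs" "[Cl 0]"]) simp_all
  also have "tangle_iso 0 0 \<dots>
      ([Op 0, Op 1, Cr b 2, Cr b 0] @ twists 2 cs @ [Cl 1, Cl 0])"
    by (rule twists_exchangeI
          [of _ "[Op 0, Op 1, Cr b 2]" 2 cs "Crossing b" 0 "[Cl 1, Cl 0]" _ _ 4]) simp_all
  also have "tangle_iso 0 0 \<dots>
      ([Op 0, Op 1, Cr b 0, Cr b 2] @ twists 2 cs @ [Cl 1, Cl 0])"
    by (rule tangle_iso_moveI[OF exchange[of 0 "Crossing b" 2 "Crossing b", simplified],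
          of _ "[Op 0, Op 1]" "twists 2 cs @ [Cl 1, Cl 0]"]) simp_all
  also have "tangle_iso 0 0 \<dots>
      ([Op 0, Op 0, Cr (\<not> b) 1, Cr b 2] @ twists 2 cs @ [Cl 1, Cl 0])"
    by (rule tangle_iso_moveI'[OF slide_opening[of 0 "\<not> b", simplified],
          of _ "[Op 0]" "[Cr b 2] @ twists 2 cs @ [Cl 1, Cl 0]"]) simp_all
  also have "tangle_iso 0 0 \<dots>
      ([Op 0, Op 2, Cr (\<not> b) 1, Cr b 2] @ twists 2 cs @ [Cl 1, Cl 0])"
    by (rule tangle_iso_moveI[OF exchange[of 0 Opening 0 Opening, simplified],
          of _ "[]" "[Cr (\<not> b) 1, Cr b 2] @ twists 2 cs @ [Cl 1, Cl 0]"]) simp_all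
  also have "tangle_iso 0 0 \<dots>
      ([Op 0, Op 1, Cr b 2, Cr b 2] @ twists 2 cs @ [Cl 1, Cl 0])"
    by (rule tangle_iso_moveI'[OF slide_opening[of 1 b, simplified],
          of _ "[Op 0]" "[Cr b 2] @ twists 2 cs @ [Cl 1, Cl 0]"]) simp_all
  finally show ?thesis .
qed

lemma over_pass_twists:
  "tangle_iso 4 4 ([Cr False 2, Cr False 1, Cr False 0] @ twists 2 cs)
     (twists 1 cs @ [Cr False 2, Cr False 1, Cr False 0])"
proof (induction cs)
  case (Cons c cs)
  have "tangle_iso 4 4 ([Cr False 2, Cr False 1, Cr False 0] @ twists 2 (c # cs))
      ([Cr c 1, Cr False 2, Cr False 1, Cr False 0] @ twists 2 cs)"
    by (rule tangle_iso_contextI[OF over_pass_Crossing, of _ "[]" c "twists 2 cs"]) simp_all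
  also have "tangle_iso 4 4 \<dots> (twists 1 (c # cs) @ [Cr False 2, Cr False 1, Cr False 0])"
    by (rule tangle_iso_contextI[OF Cons.IH, of _ "[Cr c 1]" "[]"]) simp_all
  finally show ?case .
qed simp

definition plat_closure :: "bool list \<Rightarrow> diagram" where
  "plat_closure cs = [Op 0, Op 2] @ twists 1 cs @ [Cl 0, Cl 0]"

lemma foil_eq_plat_closure: "foil k = plat_closure (replicate k True)"
  by (simp add: foil_def plat_closure_def twists_def)

text \<open>A curl makes the outer arc cross over the strand that closes up the rest of the diagram; the
  crossing then slides over the whole diagram and is undone on the other side.\<close>

lemma swing_outer_arc:
  "tangle_iso 0 0 ([Op 0, Op 1] @ twists 2 cs @ [Cl 1, Cl 0]) (plat_closure cs)"
proof -
  have "tangle_iso 0 0 ([Op 0, Op 1] @ twists 2 cs @ [Cl 1, Cl 0])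
      ([Op 0, Cr False 0, Op 1] @ twists 2 cs @ [Cl 1, Cl 0])"
    by (rule tangle_iso_moveI'[OF R1_opening[of 0 False], of _ "[]" "[Op 1] @ twists 2 cs @ [Cl 1, Cl 0]"]) simp_all
  also have "tangle_iso 0 0 \<dots>
      ([Op 0, Op 0, Cr False 2, Cr False 1, Cr False 0] @ twists 2 cs @ [Cl 1, Cl 0])"
    by (rule tangle_iso_contextI[OF over_pass_Opening[THEN tangle_iso_sym], of _ "[Op 0]" "twists 2 cs @ [Cl 1, Cl 0]"])
      simp_all
  also have "tangle_iso 0 0 \<dots>
      ([Op 0, Op 0] @ twists 1 cs @ [Cr False 2, Cr False 1, Cr False 0, Cl 1, Cl 0])"
    by (rule tangle_iso_contextI[OF over_pass_twists, of _ "[Op 0, Op 0]" cs "[Cl 1, Cl 0]"]) simp_all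
  also have "tangle_iso 0 0 \<dots> ([Op 0, Op 0] @ twists 1 cs @ [Cl 0, Cr False 0, Cl 0])"
    by (rule tangle_iso_contextI[OF over_pass_Closing, of _ "[Op 0, Op 0] @ twists 1 cs" "[Cl 0]"]) simp_all
  also have "tangle_iso 0 0 \<dots> ([Op 0, Op 0] @ twists 1 cs @ [Cl 0, Cl 0])"
    by (rule tangle_iso_moveI[OF R1_closing[of False 0], of _ "[Op 0, Op 0] @ twists 1 cs @ [Cl 0]" "[]"]) simp_all
  also have "tangle_iso 0 0 \<dots> (plat_closure cs)"
    by (rule tangle_iso_moveI[OF exchange[of 0 Opening 0 Opening, simplified], of _ "[]" "twists 1 cs @ [Cl 0, Cl 0]"])
      (simp_all add: plat_closure_def)
  finally show ?thesis .
qed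

section \<open>Cancellation of opposite crossings in a row\<close>

definition twist_sum :: "bool list \<Rightarrow> int" where
  "twist_sum cs = (\<Sum>c\<leftarrow>cs. if c then 1 else - 1)"

lemma twist_sum_simps [simp]:
  "twist_sum [] = 0"
  "twist_sum (c # cs) = (if c then 1 else - 1) + twist_sum cs"
  "twist_sum (replicate k c) = (if c then int k else - int k)"
  by (simp_all add: twist_sum_def sum_list_replicate)

text \<open>A new crossing either extends a constant row of the same label or cancels its first
  crossing by \<open>R2\<close>.\<close>

lemma twists_reduce:
  assumes "i + 2 \<le> m"
  shows "\<exists>k c. tangle_iso m m (twists i cs) (twists i (replicate k c)) \<and>
           twist_sum (replicate k c) = twist_sum cs"
proof (induction cs)
  case Nil
  show ?case
    by (rule exI[of _ 0]) simp
next
  case (Cons d cs)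
  then obtain k c where IH: "tangle_iso m m (twists i cs) (twists i (replicate k c))"
    "twist_sum (replicate k c) = twist_sum cs" by blast
  have iso: "tangle_iso m m (twists i (d # cs)) (twists i (d # replicate k c))"
    by (rule tangle_iso_contextI[OF IH(1), of _ "[Cr d i]" "[]"]) (use assms in simp_all)
  show ?case
  \<comment> \<open>For \<open>k = 0\<close> the label \<open>c\<close> is arbitrary, and the new
    row is the single crossing \<open>d\<close>.\<close>
  proof (cases "c = d \<or> k = 0")
    case True
    then have "d # replicate k c = replicate (Suc k) d"
      by auto
    with iso IH(2) True show ?thesis
      by (intro exI[of _ "Suc k"] exI[of _ d]) (auto split: if_splits)
  next
    case False
    then obtain k' where k: "k = Suc k'" "c = (\<not> d)"
      by (cases k) auto
    note iso
    also have "tangle_iso m m (twists i (d # replicate k c)) (twists i (replicate k' c))"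
      by (rule tangle_iso_moveI[OF R2[of d i], of _ "[]" "twists i (replicate k' c)"])
        (use assms in \<open>simp_all add: k\<close>)
    finally show ?thesis
      using IH(2) k by (intro exI[of _ k'] exI[of _ c]) (auto split: if_splits)
  qed
qed

section \<open>Equality of knots and mirror images\<close>

lemma isotopic_sym: "isotopic D E \<Longrightarrow> isotopic E D"
  by (simp add: isotopic_eq_tangle_iso tangle_iso_sym)

lemma isotopic_trans: "isotopic D E \<Longrightarrow> isotopic E F \<Longrightarrow> isotopic D F"
  by (auto simp: isotopic_eq_tangle_iso intro: tangle_iso_trans)

lemma mirror_simps [simp]:
  "mirror [] = []"
  "mirror ((e, i) # D) = (map_event Not e, i) # mirror D"
  "mirror (D @ E) = mirror D @ mirror E"
  "mirror (twists i cs) = twists i (map Not cs)"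
  by (simp_all add: mirror_def assign_def twists_def)

lemma mirror_mirror [simp]: "mirror (mirror D) = D"
  by (simp add: mirror_def assign_def prod.map_comp event.map_comp o_def
      event.map_ident map_prod_def split_def)

lemma width_map_event [simp]:
  "width_in (map_event h e) = width_in e" "width_out (map_event h e) = width_out e"
  by (cases e; simp)+

text \<open>Negating all labels maps each kind of move to itself; the side condition of
  \<open>R3\<close> only compares labels.\<close>

lemma local_move_mirror:
  assumes "local_move x y"
  shows "local_move (mirror x) (mirror y)"
  using assms
proof cases
  case (R3 a b c i)
  then show ?thesis
    using local_move.R3[of "\<not> a" "\<not> b" "\<not> c" i] by auto
next
  case (exchange i e j f)
  then show ?thesis
    using local_move.exchange[of i "map_event Not e" j "map_event Not f"] by simp
next
  case (slide_opening i b)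
  then show ?thesis
    using local_move.slide_opening[of i "\<not> b"] by simp
next
  case (slide_closing b i)
  then show ?thesis
    using local_move.slide_closing[of "\<not> b" i] by simp
next
  case (R1_opening i b)
  then show ?thesis
    using local_move.R1_opening[of i "\<not> b"] by simp
next
  case (R1_closing b i)
  then show ?thesis
    using local_move.R1_closing[of "\<not> b" i] by simp
next
  case (R2 b i)
  then show ?thesis
    using local_move.R2[of "\<not> b" i] by simp
qed (simp_all add: local_move.zigzag_down local_move.zigzag_up)

lemma closed_diagram_mirror [simp]: "closed_diagram (mirror D) \<longleftrightarrow> closed_diagram D"
  by (simp add: mirror_def closed_diagram_assign)

lemma isotopic_mirror:
  assumes "isotopic D E"
  shows "isotopic (mirror D) (mirror E)"
  using assms unfolding isotopic_def
proof (induction rule: equivclp_induct)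
  case (step D' E')
  have "move (mirror a) (mirror b)" if ab: "move a b" for a b
  proof -
    obtain u v x y where *: "local_move x y" "a = u @ x @ v" "b = u @ y @ v"
      using ab by (auto simp: move_def)
    have "mirror a = mirror u @ mirror x @ mirror v" "mirror b = mirror u @ mirror y @ mirror v"
      using * by simp_all
    moreover have "closed_diagram (mirror a)" "closed_diagram (mirror b)"
      using ab by (simp_all add: move_def)
    ultimately show ?thesis
      using local_move_mirror[OF *(1)] unfolding move_def by blast
  qed
  then show ?case
    using step by (meson equivclp_into_equivclp)
qed simp

lemma same_knot_cong:
  assumes "isotopic D D'"
  shows "same_knot D K \<longleftrightarrow> same_knot D' K"
  using assms unfolding same_knot_def by (meson isotopic_sym isotopic_trans)

text \<open>This lets the two choices with \<open>B\<close> opposite to \<open>L\<close> and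
  \<open>R\<close> be treated as one.\<close>

lemma same_knot_mirror: "same_knot (mirror D) K \<longleftrightarrow> same_knot D K"
  unfolding same_knot_def using isotopic_mirror mirror_mirror by metis

section \<open>Reduction of the free diagram to closed rows\<close>

definition clasp_closure :: "bool \<Rightarrow> bool \<Rightarrow> bool \<Rightarrow> bool list \<Rightarrow> diagram" where
  "clasp_closure l r b cs =
     [Op 0, Op 2, Cr l 1, Op 3, Cr b 2] @ twists 4 cs @ [Cl 3, Cr r 1, Cl 0, Cl 0]"

lemma assign_free_21n:
  "assign s (free_21n n) = clasp_closure (s L) (s R) (s B) (map (\<lambda>j. s (Row j)) [0..<n])"
  by (simp add: free_21n_def assign_def clasp_closure_def twists_def)

lemma clasp_closure_isotopic_unclasp:
  assumes "l \<noteq> r"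
  shows "isotopic (clasp_closure l r b cs) (plat_closure cs)"
proof -
  have "r = (\<not> l)"
    using assms by auto
  then show ?thesis
    unfolding isotopic_eq_tangle_iso clasp_closure_def
    using tangle_iso_trans[OF unclasp swing_outer_arc] by simp
qed

lemma clasp_closure_isotopic_reduced:
  "isotopic (clasp_closure b b b cs) (plat_closure (b # b # cs))"
  using tangle_iso_trans[OF clasp_reduction, of _ _ "plat_closure (b # b # cs)"]
    swing_outer_arc[of "b # b # cs"]
  by (simp add: isotopic_eq_tangle_iso clasp_closure_def)

text \<open>After cancellation only the signed number of crossings is left; a constant row of
  \<open>True\<close> closes to a foil, one of \<open>False\<close> to its mirror image.\<close>

lemma plat_closure_isotopic_foil:
  "isotopic (plat_closure cs)
     (if twist_sum cs \<ge> 0 then foil (nat (twist_sum cs)) else mirror (foil (nat (- twist_sum cs))))"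
proof -
  obtain k c where k: "tangle_iso 4 4 (twists 1 cs) (twists 1 (replicate k c))"
    "twist_sum (replicate k c) = twist_sum cs"
    using twists_reduce[of 1 4 cs] by auto
  have "tangle_iso 0 0 (plat_closure cs) (plat_closure (replicate k c))"
    by (rule tangle_iso_contextI[OF k(1), of _ "[Op 0, Op 2]" "[Cl 0, Cl 0]"])
      (simp_all add: plat_closure_def)
  moreover have "mirror (foil j) = plat_closure (replicate j False)" for j
    by (simp add: foil_eq_plat_closure plat_closure_def)
  ultimately show ?thesis
    using k(2) by (cases c; cases "k = 0") (auto simp: isotopic_eq_tangle_iso foil_eq_plat_closure simp flip: k(2))
qed

subsection \<open>The Kauffman bracket\<close>

text \<open>
  The Kauffman bracket at \<open>A = 2\<close>, as a state sum over labellings of the strands by booleans: a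
  crossing is \<open>A\<close> times the two horizontal arcs plus \<open>1/A\<close> times a cap followed by a cup, or the
  same with \<open>A\<close> inverted. The weights of caps and cups satisfy the zigzag identities and give a circle
  the value \<open>- 4 - 1/4 = - 17/4\<close>.
\<close>

definition cap :: "bool \<Rightarrow> bool \<Rightarrow> real" where
  "cap a b = (if a = b then 0 else if b then - 4 else 1)"

definition cup :: "bool \<Rightarrow> bool \<Rightarrow> real" where
  "cup a b = (if a = b then 0 else if b then 1 else - 1 / 4)"

fun weight :: "bool event \<Rightarrow> bool list \<Rightarrow> bool list \<Rightarrow> real" where
  "weight Opening p q = cup (q ! 0) (q ! 1)"
| "weight Closing p q = cap (p ! 0) (p ! 1)"
| "weight (Crossing c) p q = (if c then 2 else 1 / 2) * of_bool (p = q)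
     + (if c then 1 / 2 else 2) * cap (p ! 0) (p ! 1) * cup (q ! 0) (q ! 1)"

text \<open>Here \<open>f\<close> is the state sum of everything to the right of the event, as a
  function of the labels on the sweeping line; \<open>act\<close> moves that line one event to the
  left.\<close>

fun act :: "bool event \<times> nat \<Rightarrow> (bool list \<Rightarrow> real) \<Rightarrow> bool list \<Rightarrow> real" where
  "act (e, i) f xs = (\<Sum>q | length q = width_out e.
     weight e (take (width_in e) (drop i xs)) q * f (take i xs @ q @ drop (i + width_in e) xs))"

declare act.simps [simp del]

definition transfer :: "diagram \<Rightarrow> (bool list \<Rightarrow> real) \<Rightarrow> bool list \<Rightarrow> real" where
  "transfer D f = foldr act D f"

text \<open>For a closed diagram, the state after the last event is the empty list, so the value of the
  final function at other lists is irrelevant.\<close>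

definition bracket :: "diagram \<Rightarrow> real" where
  "bracket D = transfer D (\<lambda>_. 1) []"

lemma transfer_simps [simp]:
  "transfer [] f = f"
  "transfer (x # D) f = act x (transfer D f)"
  "transfer (D @ E) f = transfer D (transfer E f)"
  by (simp_all add: transfer_def)

lemma act_linear: "act x (\<lambda>xs. c * f xs + d * g xs) xs = c * act x f xs + d * act x g xs"
  by (cases x) (simp add: act.simps sum.distrib sum_distrib_left algebra_simps)

lemma transfer_linear:
  "transfer D (\<lambda>xs. c * f xs + d * g xs) xs = c * transfer D f xs + d * transfer D g xs"
proof (induction D arbitrary: xs)
  case (Cons x D)
  then have "transfer D (\<lambda>xs. c * f xs + d * g xs) = (\<lambda>xs. c * transfer D f xs + d * transfer D g xs)"
    by blast
  then show ?case
    by (simp add: act_linear)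
qed simp

text \<open>Only labellings of the right length occur in the sums. The identities for local moves
  are available only for such labellings.\<close>

lemma transfer_cong:
  assumes "tangle m D n" "length xs = m" "\<And>ys. length ys = n \<Longrightarrow> f ys = g ys"
  shows "transfer D f xs = transfer D g xs"
  using assms
proof (induction m D n arbitrary: xs rule: tangle.induct)
  case (2 m e i D n)
  have "transfer D f (take i xs @ q @ drop (i + width_in e) xs) =
      transfer D g (take i xs @ q @ drop (i + width_in e) xs)" if "length q = width_out e" for q
    using 2(2-4) that by (intro 2(1)) (auto simp: tangle.simps(2))
  then show ?case
    by (auto simp: act.simps intro!: sum.cong)
qed simp

lemma lists_length_2: "{q :: bool list. length q = 2} = {[False, False], [False, True], [True, False], [True, True]}"
proof -
  have "q \<in> {[False, False], [False, True], [True, False], [True, True]}" if q: "length q = 2" for q :: "bool list"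
  proof -
    obtain a b where "q = [a, b]"
      using q by (cases q; cases "tl q") auto
    then show ?thesis
      by (cases a; cases b) simp_all
  qed
  then show ?thesis
    by auto
qed

lemma act_Opening:
  "length ys = i \<Longrightarrow> act (Op i) f (ys @ zs) = f (ys @ False # True # zs) - f (ys @ True # False # zs) / 4"
  by (simp add: act.simps lists_length_2 cup_def)

lemma act_Closing:
  "length ys = i \<Longrightarrow> act (Cl i) f (ys @ a # b # zs) = cap a b * f (ys @ zs)"
  by (simp add: act.simps)

lemma act_Crossing:
  "length ys = i \<Longrightarrow> act (Cr c i) f (ys @ a # b # zs) =
     (if c then 2 else 1 / 2) * f (ys @ a # b # zs)
     + (if c then 1 / 2 else 2) * cap a b * (f (ys @ False # True # zs) - f (ys @ True # False # zs) / 4)"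
  by (cases a; cases b) (simp_all add: act.simps lists_length_2 cap_def cup_def field_simps)

text \<open>The events of a move sit at \<open>i\<close> and \<open>Suc i\<close>; these forms
  evaluate the second kind on the same splitting of the list at \<open>i\<close>.\<close>

lemma act_Suc:
  assumes "length ys = i"
  shows "act (Op (Suc i)) f (ys @ a # zs) =
      f (ys @ a # False # True # zs) - f (ys @ a # True # False # zs) / 4"
    and "act (Cl (Suc i)) f (ys @ a # b # d # zs) = cap b d * f (ys @ a # zs)"
    and "act (Cr c (Suc i)) f (ys @ a # b # d # zs) =
      (if c then 2 else 1 / 2) * f (ys @ a # b # d # zs)
      + (if c then 1 / 2 else 2) * cap b d *
          (f (ys @ a # False # True # zs) - f (ys @ a # True # False # zs) / 4)"
  using assms act_Opening[of "ys @ [a]" "Suc i" f zs] act_Closing[of "ys @ [a]" "Suc i" f b d zs]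
    act_Crossing[of "ys @ [a]" "Suc i" c f b d zs]
  by simp_all

text \<open>The labels are cut into five blocks: above \<open>e\<close>, at \<open>e\<close>,
  between, at \<open>f\<close>, below \<open>f\<close>. The two sums act on separate blocks and can
  be interchanged.\<close>

lemma act_exchange:
  assumes "i + width_in e \<le> j" "j + width_in f \<le> length xs"
  shows "act (f, j) (act (e, i) g) xs = act (e, i) (act (f, j + width_out e - width_in e) g) xs"
proof -
  define as bs cs ds es where "as = take i xs" and "bs = take (width_in e) (drop i xs)"
    and "cs = take (j - (i + width_in e)) (drop (i + width_in e) xs)"
    and "ds = take (width_in f) (drop j xs)" and "es = drop (j + width_in f) xs"
  have len: "length as = i" "length bs = width_in e" "length ds = width_in f" 
    and j: "j = i + width_in e + length cs"
    using assms by (auto simp: as_def bs_def cs_def ds_def)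
  have xs: "xs = as @ bs @ cs @ ds @ es"
  proof -
    have "drop j xs = ds @ es"
      unfolding ds_def es_def by (metis append_take_drop_id drop_drop add.commute)
    moreover have "drop (i + width_in e) xs = cs @ drop j xs"
      using assms unfolding cs_def by (metis append_take_drop_id drop_drop le_add_diff_inverse2)
    moreover have "drop i xs = bs @ drop (i + width_in e) xs"
      unfolding bs_def by (metis append_take_drop_id drop_drop add.commute)
    ultimately show ?thesis
      unfolding as_def by (metis append_take_drop_id)
  qed
  have "act (f, j) (act (e, i) g) xs =
      (\<Sum>q | length q = width_out f. \<Sum>p | length p = width_out e.
         weight f ds q * (weight e bs p * g (as @ p @ cs @ q @ es)))"
    unfolding xs j by (simp add: act.simps len sum_distrib_left)
  also have "\<dots> = (\<Sum>p | length p = width_out e. \<Sum>q | length q = width_out f.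
         weight e bs p * (weight f ds q * g (as @ p @ cs @ q @ es)))"
    by (subst sum.swap) (simp add: mult.left_commute)
  also have "\<dots> = act (e, i) (act (f, j + width_out e - width_in e) g) xs"
    unfolding xs j by (simp add: act.simps len sum_distrib_left)
  finally show ?thesis .
qed

lemma split_at_1: "i < length xs \<Longrightarrow> \<exists>ys a zs. xs = ys @ a # zs \<and> length ys = i"
  by (metis id_take_nth_drop length_take less_imp_le min.absorb2)

lemma split_at_2: "i + 2 \<le> length xs \<Longrightarrow> \<exists>ys a b zs. xs = ys @ a # b # zs \<and> length ys = i"
  using split_at_1[of i xs] split_at_1[of "Suc i" xs]
  by (metis Cons_nth_drop_Suc Suc_le_lessD add_2_eq_Suc' append_take_drop_id length_take less_imp_le
      min.absorb2 Suc_le_eq)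

lemma split_at_3: "i + 3 \<le> length xs \<Longrightarrow> \<exists>ys a b c zs. xs = ys @ a # b # c # zs \<and> length ys = i"
proof -
  assume *: "i + 3 \<le> length xs"
  then obtain ys a b zs where xs: "xs = ys @ a # b # zs" "length ys = i"
    using split_at_2[of i xs] by auto
  with * obtain c zs' where "zs = c # zs'"
    by (cases zs) auto
  with xs show ?thesis
    by blast
qed

lemmas act_simps = act_Opening act_Closing act_Crossing act_Suc cap_def

text \<open>The factor \<open>- 8 = - A\<^sup>3\<close> or its inverse comes from the first Reidemeister move.\<close>

lemma local_move_transfer:
  assumes "local_move x y" "tangle m x n" "tangle m y n"
  shows "\<exists>k :: int. \<forall>g xs. length xs = m \<longrightarrow> transfer x g xs = (- 8) powi k * transfer y g xs"
  using assms
proof cases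
  case (exchange i e j f)
  have "j + width_in f \<le> m"
    using assms(2) exchange by (simp add: tangle.simps(2))
  then show ?thesis
    using exchange by (intro exI[of _ 0]) (simp add: act_exchange)
next
  case (zigzag_down i)
  show ?thesis
  proof (intro exI[of _ 0] allI impI)
    fix g :: "bool list \<Rightarrow> real" and xs :: "bool list"
    assume "length xs = m"
    then obtain ys a zs where "xs = ys @ a # zs" "length ys = i"
      using split_at_1[of i xs] assms(2) zigzag_down by auto
    then show "transfer x g xs = (- 8) powi 0 * transfer y g xs"
      using zigzag_down by (cases a) (simp_all add: act_simps)
  qed
next
  case (zigzag_up i)
  show ?thesis
  proof (intro exI[of _ 0] allI impI)
    fix g :: "bool list \<Rightarrow> real" and xs :: "bool list"
    assume "length xs = m"
    then obtain ys a zs where "xs = ys @ a # zs" "length ys = i"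
      using split_at_1[of i xs] assms(2) zigzag_up by auto
    then show "transfer x g xs = (- 8) powi 0 * transfer y g xs"
      using zigzag_up by (cases a) (simp_all add: act_simps)
  qed
next
  case (slide_opening i b)
  show ?thesis
  proof (intro exI[of _ 0] allI impI)
    fix g :: "bool list \<Rightarrow> real" and xs :: "bool list"
    assume "length xs = m"
    then obtain ys a zs where "xs = ys @ a # zs" "length ys = i"
      using split_at_1[of i xs] assms(2) slide_opening by auto
    then show "transfer x g xs = (- 8) powi 0 * transfer y g xs"
      using slide_opening by (cases a; cases b) (simp_all add: act_simps field_simps)
  qed
next
  case (slide_closing b i)
  show ?thesis
  proof (intro exI[of _ 0] allI impI)
    fix g :: "bool list \<Rightarrow> real" and xs :: "bool list"
    assume "length xs = m"
    then obtain ys a c d zs where "xs = ys @ a # c # d # zs" "length ys = i"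
      using split_at_3[of i xs] assms(2) slide_closing by auto
    then show "transfer x g xs = (- 8) powi 0 * transfer y g xs"
      using slide_closing by (cases a; cases b; cases c; cases d) (simp_all add: act_simps field_simps)
  qed
next
  case (R1_opening i b)
  show ?thesis
  \<comment> \<open>A curl labelled \<open>True\<close> contributes 2 + (1/2)(- 17/4) = - 1/8, one
    labelled \<open>False\<close> 1/2 + 2(- 17/4) = - 8.\<close>
  proof (intro exI[of _ "if b then - 1 else 1"] allI impI)
    fix g :: "bool list \<Rightarrow> real" and xs :: "bool list"
    assume "length xs = m"
    moreover define ys zs where "ys = take i xs" "zs = drop i xs"
    ultimately have "xs = ys @ zs" "length ys = i"
      using assms(2) R1_opening by auto
    then show "transfer x g xs = (- 8) powi (if b then - 1 else 1) * transfer y g xs"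
      using R1_opening by (cases b) (simp_all add: act_simps field_simps)
  qed
next
  case (R1_closing b i)
  show ?thesis
  proof (intro exI[of _ "if b then - 1 else 1"] allI impI)
    fix g :: "bool list \<Rightarrow> real" and xs :: "bool list"
    assume "length xs = m"
    then obtain ys a c zs where "xs = ys @ a # c # zs" "length ys = i"
      using split_at_2[of i xs] assms(2) R1_closing by auto
    then show "transfer x g xs = (- 8) powi (if b then - 1 else 1) * transfer y g xs"
      using R1_closing by (cases a; cases b; cases c) (simp_all add: act_simps field_simps)
  qed
next
  case (R2 b i)
  show ?thesis
  proof (intro exI[of _ 0] allI impI)
    fix g :: "bool list \<Rightarrow> real" and xs :: "bool list"
    assume "length xs = m"
    then obtain ys a c zs where "xs = ys @ a # c # zs" "length ys = i"
      using split_at_2[of i xs] assms(2) R2 by auto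
    then show "transfer x g xs = (- 8) powi 0 * transfer y g xs"
      using R2 by (cases a; cases b; cases c) (simp_all add: act_simps field_simps)
  qed
next
  case (R3 a b c i)
  show ?thesis
  proof (intro exI[of _ 0] allI impI)
    fix g :: "bool list \<Rightarrow> real" and xs :: "bool list"
    assume "length xs = m"
    then obtain ys d e f zs where "xs = ys @ d # e # f # zs" "length ys = i"
      using split_at_3[of i xs] assms(2) R3 by auto
    then show "transfer x g xs = (- 8) powi 0 * transfer y g xs"
      using R3 by (cases a; cases b; cases c; cases d; cases e; cases f)
        (simp_all add: act_simps field_simps)
  qed
qed

text \<open>The scalar of a local move passes through the linear transfer of the surrounding
  diagram. Along a chain of moves the exponents add up, with opposite sign for moves made
  backwards.\<close>

lemma bracket_isotopic:
  assumes "isotopic D E"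
  shows "\<exists>k :: int. bracket D = (- 8) powi k * bracket E"
  using assms unfolding isotopic_eq_tangle_iso tangle_iso_def
proof (induction rule: equivclp_induct)
  case base
  show ?case
    by (rule exI[of _ 0]) simp
next
  case (step E F)
  have move: "\<exists>k :: int. bracket a = (- 8) powi k * bracket b" if ab: "tangle_move 0 0 a b" for a b
  proof -
    obtain u v x y where *: "local_move x y" "a = u @ x @ v" "b = u @ y @ v"
      using ab by (auto simp: tangle_move_def)
    have "tangle 0 (u @ x @ v) 0" "tangle 0 (u @ y @ v) 0"
      using ab * by (auto simp: tangle_move_def)
    then obtain m n m' n' where t: "tangle 0 u m" "tangle m x n" "tangle n v 0"
        "tangle 0 u m'" "tangle m' y n'" "tangle n' v 0"
      unfolding tangle_append by blast
    \<comment> \<open>Both sides of the move sit between the same \<open>u\<close> and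
      \<open>v\<close>, which fix the numbers of strands.\<close>
    have "m' = m" "n' = n"
      using t tangle_target_unique tangle_source_unique by blast+
    then obtain k :: int where k: "\<And>g xs. length xs = m \<Longrightarrow> transfer x g xs = (- 8) powi k * transfer y g xs"
      using local_move_transfer[OF *(1) t(2)] t(5) by blast
    have "bracket a = transfer u (transfer x (transfer v (\<lambda>_. 1))) []"
      by (simp add: bracket_def *)
    \<comment> \<open>The summand \<open>0 * 0\<close> brings the function into the two-term form of
      \<open>transfer_linear\<close>.\<close>
    also have "\<dots> = transfer u (\<lambda>xs. (- 8) powi k * transfer y (transfer v (\<lambda>_. 1)) xs + 0 * 0) []"
      by (rule transfer_cong[OF t(1)]) (simp_all add: k)
    also have "\<dots> = (- 8) powi k * bracket b"
      by (subst transfer_linear) (simp add: bracket_def *)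
    finally show ?thesis
      by blast
  qed
  obtain k :: int where k: "bracket D = (- 8) powi k * bracket E"
    using step.IH by blast
  obtain j :: int where "bracket E = (- 8) powi j * bracket F"
  proof (cases "tangle_move 0 0 E F")
    case True
    then show ?thesis
      using move that by blast
  next
    case False
    then obtain j :: int where "bracket F = (- 8) powi j * bracket E"
      using step.hyps move by blast
    then have "bracket E = (- 8) powi (- j) * bracket F"
      by (simp add: power_int_minus)
    then show ?thesis
      using that by blast
  qed
  then have "bracket D = (- 8) powi (k + j) * bracket F"
    using k by (simp add: power_int_add)
  then show ?case
    by blast
qed

subsection \<open>Values of the bracket and the count\<close>

text \<open>A twist acts as \<open>A = 2\<close> (or \<open>1/2\<close>) times the identity plus a multiple of the cap followed by the cup,
  and as \<open>- 1/8\<close> (or \<open>- 8\<close>) on the image of the latter.\<close>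

lemma transfer_twists:
  assumes "i + 2 \<le> length xs"
  shows "transfer (twists i cs) f xs = 2 powi twist_sum cs * f xs
    + 4 / 17 * (2 powi twist_sum cs - (- 1 / 8) powi twist_sum cs) * transfer [Cl i, Op i] f xs"
  using assms
proof (induction cs arbitrary: xs)
  case (Cons c cs)
  \<comment> \<open>A closing followed by an opening squares to \<open>- 17 / 4\<close> times
    itself, so its coefficient is \<open>(Q - P) / (- 17 / 4)\<close>, that is,
    \<open>4 / 17 * (P - Q)\<close>.\<close>
  define P Q :: real where PQ: "P = 2 powi twist_sum cs" "Q = (- 1 / 8) powi twist_sum cs"
  obtain ys a b zs where xs: "xs = ys @ a # b # zs" "length ys = i"
    using split_at_2[OF Cons.prems] by blast
  have IH: "transfer (twists i cs) f (ys @ a' # b' # zs) = P * f (ys @ a' # b' # zs)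
      + 4 / 17 * (P - Q) * transfer [Cl i, Op i] f (ys @ a' # b' # zs)" for a' b'
    using Cons.IH[of "ys @ a' # b' # zs"] xs by (simp add: PQ)
  have powers: "2 powi twist_sum (c # cs) = (if c then 2 else 1 / 2) * P"
    "(- 1 / 8) powi twist_sum (c # cs) = (if c then - 1 / 8 else - 8) * Q"
    by (simp_all add: PQ power_int_add power_int_diff)
  show ?case
    unfolding powers xs(1) using xs(2)
    by (cases a; cases b; cases c) (simp_all add: act_simps IH field_simps)
qed simp

text \<open>The brackets for all rows follow from two values: with the row untwisted and with the
  row cut into two arcs.\<close>

lemma bracket_twists:
  assumes "tangle 0 u m" "i + 2 \<le> m"
  shows "bracket (u @ twists i cs @ v) = 2 powi twist_sum cs * bracket (u @ v)
    + 4 / 17 * (2 powi twist_sum cs - (- 1 / 8) powi twist_sum cs) * bracket (u @ [Cl i, Op i] @ v)"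
    (is "_ = ?p * _ + ?q * _")
proof -
  let ?f = "transfer v (\<lambda>_. 1)"
  have "bracket (u @ twists i cs @ v) = transfer u (transfer (twists i cs) ?f) []"
    by (simp add: bracket_def)
  also have "\<dots> = transfer u (\<lambda>xs. ?p * ?f xs + ?q * transfer [Cl i, Op i] ?f xs) []"
    using assms(2) by (intro transfer_cong[OF assms(1)] transfer_twists) auto
  also have "\<dots> = ?p * transfer u ?f [] + ?q * transfer u (transfer [Cl i, Op i] ?f) []"
    by (rule transfer_linear)
  finally show ?thesis
    by (simp add: bracket_def)
qed

text \<open>Forms with explicit indices, by which the simplifier evaluates the bracket of a concrete
  diagram.\<close>

lemma act_concrete:
  "act (Op i) f xs = f (take i xs @ False # True # drop i xs) - f (take i xs @ True # False # drop i xs) / 4"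
  "i + 2 \<le> length xs \<Longrightarrow> act (Cl i) f xs = cap (xs ! i) (xs ! (i + 1)) * f (take i xs @ drop (i + 2) xs)"
  "i + 2 \<le> length xs \<Longrightarrow> act (Cr c i) f xs = (if c then 2 else 1 / 2) * f xs
     + (if c then 1 / 2 else 2) * act (Cl i) (act (Op i) f) xs"
  subgoal by (simp add: act.simps lists_length_2 cup_def)
  subgoal using split_at_2[of i xs] by (auto simp: act_simps nth_append)
  subgoal using split_at_2[of i xs] by (auto simp: act_simps)
  done

lemma bracket_plat_closure:
  "bracket (plat_closure cs) = 273 / 16 * 2 powi twist_sum cs + (- 1 / 8) powi twist_sum cs"
proof -
  \<comment> \<open>These are two circles and one circle, with \<open>- 17 / 4\<close> for each
    circle.\<close>
  have vals: "bracket ([Op 0, Op 2] @ [Cl 0, Cl 0]) = 289 / 16"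
    "bracket ([Op 0, Op 2] @ [Cl 1, Op 1] @ [Cl 0, Cl 0]) = - 17 / 4"
    by (simp_all add: bracket_def act_concrete cap_def)
  have wf: "tangle 0 [Op 0, Op 2] 4" "(1 :: nat) + 2 \<le> 4"
    by simp_all
  show ?thesis
    unfolding plat_closure_def bracket_twists[OF wf] vals by (simp add: algebra_simps)
qed

lemma bracket_clasp_closure:
  "bracket (clasp_closure True True False cs) =
     - 65793 / 512 * 2 powi twist_sum cs + 3839 / 32 * (- 1 / 8) powi twist_sum cs"
proof -
  let ?u = "[Op 0, Op 2, Cr True 1, Op 3, Cr False 2]" and ?v = "[Cl 3, Cr True 1, Cl 0, Cl 0]"
  \<comment> \<open>Without the row, \<open>B\<close> is a curl of factor - 1/8 on a Hopf link of
    bracket 4369/64. With the row cut, the value is that of \<open>plat_closure\<close> for three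
    crossings \<open>False\<close>, a trefoil.\<close>
  have "bracket (?u @ ?v) = - 4369 / 512"
    "bracket (?u @ [Cl 4, Op 4] @ ?v) = - 65263 / 128"
    by (simp_all add: bracket_def act_concrete cap_def)
  then show ?thesis
    using bracket_twists[of ?u 6 4 cs ?v]
    by (simp add: clasp_closure_def algebra_simps)
qed

text \<open>Brackets of isotopic diagrams differ by a sign and a power of 8, so the odd part of the absolute
  value of the bracket is a knot invariant.\<close>

definition odd_part :: "real \<Rightarrow> int \<Rightarrow> bool" where
  "odd_part x a \<longleftrightarrow> odd a \<and> a > 0 \<and> (\<exists>i j :: nat. 2 ^ i * \<bar>x\<bar> = 2 ^ j * real_of_int a)"

lemma odd_partI:
  assumes "odd a" "a > 0" "real_of_int a = y" "x = y / 2 ^ i \<or> x = - (y / 2 ^ i)"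
  shows "odd_part x a"
proof -
  have "2 ^ i * \<bar>x\<bar> = 2 ^ 0 * real_of_int a"
    using assms(2-4) by auto
  with assms(1,2) show ?thesis
    unfolding odd_part_def by blast
qed

lemma one_le_power_16: "1 \<le> (16 :: int) ^ m"
  by simp

text \<open>After clearing denominators, two odd integers times powers of 2 agree, so the exponents
  agree.\<close>

lemma odd_part_unique:
  assumes "odd_part x a" "odd_part x b"
  shows "a = b"
proof -
  obtain i j i' j' where *: "2 ^ i * \<bar>x\<bar> = 2 ^ j * real_of_int a" "2 ^ i' * \<bar>x\<bar> = 2 ^ j' * real_of_int b"
    using assms by (auto simp: odd_part_def)
  have "2 ^ (i' + j) * real_of_int a = 2 ^ i' * (2 ^ i * \<bar>x\<bar>)"
    by (simp add: *(1) power_add)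
  also have "\<dots> = 2 ^ i * (2 ^ i' * \<bar>x\<bar>)"
    by simp
  also have "\<dots> = 2 ^ (i + j') * real_of_int b"
    by (simp add: *(2) power_add)
  finally have "real_of_int (2 ^ (i' + j) * a) = real_of_int (2 ^ (i + j') * b)"
    by simp
  then have eq: "2 ^ (i' + j) * a = 2 ^ (i + j') * b"
    unfolding of_int_eq_iff .
  have aux: "p \<ge> q" if "2 ^ p * c = 2 ^ q * d" "odd c" for p q :: nat and c d :: int
  proof (rule ccontr)
    assume "\<not> p \<ge> q"
    then have "2 ^ q = (2 :: int) ^ p * 2 ^ (q - p)"
      by (simp flip: power_add)
    with that(1) have "c = 2 ^ (q - p) * d"
      by simp
    then show False
      using \<open>\<not> p \<ge> q\<close> that(2) by simp
  qed
  have "i' + j = i + j'"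
    using aux[OF eq] aux[OF eq[symmetric]] assms by (simp add: odd_part_def)
  with eq show ?thesis
    by simp
qed

lemma odd_part_isotopic:
  assumes "isotopic D E" "odd_part (bracket D) a"
  shows "odd_part (bracket E) a"
proof -
  obtain k :: int where k: "bracket D = (- 8) powi k * bracket E"
    using bracket_isotopic[OF assms(1)] by blast
  obtain i j where ij: "2 ^ i * \<bar>bracket D\<bar> = 2 ^ j * real_of_int a" and a: "odd a" "a > 0"
    using assms(2) by (auto simp: odd_part_def)
  have "\<exists>p q :: nat. 2 ^ p * \<bar>(- 8) powi k\<bar> = (2 ^ q :: real)"
  proof (cases "k \<ge> 0")
    case True
    then show ?thesis
      by (intro exI[of _ 0] exI[of _ "3 * nat k"]) (simp add: power_int_def power_abs power_mult)
  next
    case False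
    then show ?thesis
      by (intro exI[of _ "3 * nat (- k)"] exI[of _ 0])
        (simp add: power_int_def power_abs power_mult flip: power_mult_distrib)
  qed
  then obtain p q :: nat where pq: "2 ^ p * \<bar>(- 8) powi k\<bar> = (2 ^ q :: real)"
    by blast
  have "2 ^ (i + q) * \<bar>bracket E\<bar> = 2 ^ p * (2 ^ i * \<bar>bracket D\<bar>)"
    by (simp add: k abs_mult power_add flip: pq)
  also have "\<dots> = 2 ^ (p + j) * real_of_int a"
    by (simp add: ij power_add)
  finally show ?thesis
    using a unfolding odd_part_def by blast
qed

text \<open>Both powers are put over the denominator \<open>2 ^ (3 * m)\<close>, using
  \<open>2 ^ m = 16 ^ m / 8 ^ m\<close>; the parity of \<open>m\<close> fixes the sign of the
  second.\<close>

lemma powi_positive: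
  assumes "w = int m + 3" "even m"
  shows "(2 :: real) powi w = 8 * 16 ^ m / 2 ^ (3 * m)" "(- 1 / 8 :: real) powi w = - 1 / 512 / 2 ^ (3 * m)"
proof -
  have "(16 :: real) ^ m = 2 ^ m * 2 ^ (3 * m)"
    by (simp add: power_mult flip: power_mult_distrib)
  then show "(2 :: real) powi w = 8 * 16 ^ m / 2 ^ (3 * m)"
    by (simp add: assms(1) power_int_add)
  have "(- 1 / 8 :: real) powi w = (- 1 / 8) ^ m * (- 1 / 8) ^ 3"
    by (simp add: assms(1) power_int_add)
  then show "(- 1 / 8 :: real) powi w = - 1 / 512 / 2 ^ (3 * m)"
    using assms(2) by (simp add: power_mult power_divide)
qed

lemma powi_negative:
  assumes "w = - int m - 1" "even m"
  shows "(2 :: real) powi w = 1 / 2 / 2 ^ m" "(- 1 / 8 :: real) powi w = - 8 * 16 ^ m / 2 ^ m"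
proof -
  show "(2 :: real) powi w = 1 / 2 / 2 ^ m"
    by (simp add: assms(1) power_int_diff power_int_minus field_simps)
  have "(- 1 / 8 :: real) powi w = inverse ((- 1 / 8) ^ m) * (- 8)"
    by (simp add: assms(1) power_int_diff power_int_minus)
  moreover have "(16 :: real) ^ m = 2 ^ m * 8 ^ m"
    by (simp flip: power_mult_distrib)
  ultimately show "(- 1 / 8 :: real) powi w = - 8 * 16 ^ m / 2 ^ m"
    using assms(2) by (simp add: power_divide)
qed

section \<open>Odd parts of the brackets and their separation\<close>

lemma odd_part_plat_closure:
  shows "twist_sum cs = 1 \<Longrightarrow> odd_part (bracket (plat_closure cs)) 17"
    and "twist_sum cs = - 1 \<Longrightarrow> odd_part (bracket (plat_closure cs)) 17"
    and "twist_sum cs = int m + 3 \<Longrightarrow> even m \<Longrightarrow> odd_part (bracket (plat_closure cs)) (69888 * 16 ^ m - 1)"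
    and "twist_sum cs = - int m - 3 \<Longrightarrow> even m \<Longrightarrow> odd_part (bracket (plat_closure cs)) (65536 * 16 ^ m - 273)"
proof -
  show "odd_part (bracket (plat_closure cs)) 17" if "twist_sum cs = 1"
    unfolding odd_part_def bracket_plat_closure that
    \<comment> \<open>The bracket is 34 here and 17/32 in the next case.\<close>
    by (simp, intro exI[of _ 1] exI[of _ 2], simp)
  show "odd_part (bracket (plat_closure cs)) 17" if "twist_sum cs = - 1"
    unfolding odd_part_def bracket_plat_closure that
    by (simp, intro exI[of _ 5] exI[of _ 0], simp)
next
  assume "twist_sum cs = int m + 3" "even m"
  note powi = powi_positive[OF this]
  have "bracket (plat_closure cs) = (69888 * 16 ^ m - 1) / 2 ^ (3 * m + 9)"
    unfolding bracket_plat_closure powi by (simp add: power_add field_simps)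
  then show "odd_part (bracket (plat_closure cs)) (69888 * 16 ^ m - 1)"
    using one_le_power_16[of m] by (intro odd_partI[OF _ _ _ disjI1]) (simp, linarith, simp_all)
next
  assume "twist_sum cs = - int m - 3" "even m"
  then have "twist_sum cs = - int (m + 2) - 1" "even (m + 2)"
    by simp_all
  note powi = powi_negative[OF this]
  have "bracket (plat_closure cs) = - ((65536 * 16 ^ m - 273) / 2 ^ (m + 7))"
    unfolding bracket_plat_closure powi by (simp add: power_add field_simps)
  then show "odd_part (bracket (plat_closure cs)) (65536 * 16 ^ m - 273)"
    using one_le_power_16[of m] by (intro odd_partI[OF _ _ _ disjI2]) (simp, linarith, simp_all)
qed

lemma odd_part_clasp_closure:
  shows "twist_sum cs = 1 \<Longrightarrow> odd_part (bracket (clasp_closure True True False cs)) 17"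
    and "twist_sum cs = int m + 3 \<Longrightarrow> even m \<Longrightarrow>
      odd_part (bracket (clasp_closure True True False cs)) (16843008 * 16 ^ m + 3839)"
    and "twist_sum cs = - int m - 1 \<Longrightarrow> even m \<Longrightarrow>
      odd_part (bracket (clasp_closure True True False cs)) (982784 * 16 ^ m + 65793)"
proof -
  show "odd_part (bracket (clasp_closure True True False cs)) 17" if "twist_sum cs = 1"
    unfolding odd_part_def bracket_clasp_closure that
    \<comment> \<open>The bracket is - 272 = - 16 * 17.\<close>
    by (simp, intro exI[of _ 0] exI[of _ 4], simp)
next
  assume "twist_sum cs = int m + 3" "even m"
  note powi = powi_positive[OF this]
  have "bracket (clasp_closure True True False cs) = - ((16843008 * 16 ^ m + 3839) / 2 ^ (3 * m + 14))"
    unfolding bracket_clasp_closure powi by (simp add: power_add field_simps)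
  then show "odd_part (bracket (clasp_closure True True False cs)) (16843008 * 16 ^ m + 3839)"
    using one_le_power_16[of m] by (intro odd_partI[OF _ _ _ disjI2]) (simp, linarith, simp_all)
next
  assume "twist_sum cs = - int m - 1" "even m"
  note powi = powi_negative[OF this]
  have "bracket (clasp_closure True True False cs) = - ((982784 * 16 ^ m + 65793) / 2 ^ (m + 10))"
    unfolding bracket_clasp_closure powi by (simp add: power_add field_simps)
  then show "odd_part (bracket (clasp_closure True True False cs)) (982784 * 16 ^ m + 65793)"
    using one_le_power_16[of m] by (intro odd_partI[OF _ _ _ disjI2]) (simp, linarith, simp_all)
qed

text \<open>Modulo 256 the four families are - 1 and - 17 for closed rows, - 1 and 1 for clasps.
  Only the two families congruent to - 1 need a finer argument, and 17 is excluded by size.\<close>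

lemma odd_parts_disjoint:
  fixes X Y :: int
  assumes "X = 16 ^ m" "Y = 16 ^ j"
  shows "69888 * X - 1 \<noteq> 65536 * Y - 273" "16843008 * X + 3839 \<noteq> 69888 * Y - 1"
    "16843008 * X + 3839 \<noteq> 65536 * Y - 273" "982784 * X + 65793 \<noteq> 69888 * Y - 1"
    "982784 * X + 65793 \<noteq> 65536 * Y - 273" "17 \<noteq> 69888 * Y - 1" "17 \<noteq> 65536 * Y - 273"
proof -
  have residue: "d * z \<noteq> c" if "c mod d \<noteq> 0" for c d z :: int
    using that by auto
  show "69888 * X - 1 \<noteq> 65536 * Y - 273" "16843008 * X + 3839 \<noteq> 65536 * Y - 273"
    "982784 * X + 65793 \<noteq> 69888 * Y - 1" "982784 * X + 65793 \<noteq> 65536 * Y - 273"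
    using residue[of "- 272" 256 "273 * X - 256 * Y"] residue[of "- 4112" 256 "65793 * X - 256 * Y"]
      residue[of "- 65794" 256 "3839 * X - 273 * Y"] residue[of "- 66066" 256 "3839 * X - 256 * Y"]
    by simp_all
  have power_16_cases: "(16 :: int) ^ p = 1 \<or> (\<exists>x\<ge>1. (16 :: int) ^ p = 16 * x)" for p
  proof (cases p)
    case (Suc q)
    then show ?thesis
      by (intro disjI2 exI[of _ "16 ^ q"]) simp
  qed simp
  \<comment> \<open>Division by 256 leaves \<open>65793 * X + 15 = 273 * Y\<close>. This fails
    modulo 16 if 16 divides \<open>X\<close> and \<open>Y\<close>, by size if \<open>Y = 1\<close>,
    and by divisibility if \<open>X = 1\<close> and 16 divides \<open>Y\<close>.\<close>
  consider "X = 1" "Y = 1" | y where "X = 1" "Y = 16 * y" | x where "x \<ge> 1" "X = 16 * x" "Y = 1"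
    | x y where "X = 16 * x" "Y = 16 * y"
    using power_16_cases[of m] power_16_cases[of j] assms by metis
  then show "16843008 * X + 3839 \<noteq> 69888 * Y - 1"
  proof cases
    case (2 y)
    then show ?thesis
      using residue[of 65808 4368 y] by simp
  next
    case (4 x y)
    then show ?thesis
      using residue[of "- 15" 16 "65793 * x - 273 * y"] by simp
  qed simp_all
  have "Y \<ge> 1"
    using assms by simp
  then show "17 \<noteq> 69888 * Y - 1" "17 \<noteq> 65536 * Y - 273"
    by simp_all
qed

lemma odd_nat_ge_3E:
  assumes "odd (k :: nat)" "3 \<le> k"
  obtains j where "k = j + 3" "even j"
  using assms that[of "k - 3"] by simp

text \<open>The two values belong to the foil and to its mirror image, which
  \<open>same_knot\<close> does not distinguish.\<close>

lemma foil_odd_part_cases: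
  assumes "same_knot D (foil (j + 3))" "even j" "odd_part (bracket D) a"
  shows "a = 69888 * 16 ^ j - 1 \<or> a = 65536 * 16 ^ j - 273"
proof -
  have mirror: "mirror (foil (j + 3)) = plat_closure (replicate (j + 3) False)"
    by (simp add: foil_eq_plat_closure plat_closure_def del: replicate.simps)
  from assms(1) consider "isotopic D (plat_closure (replicate (j + 3) True))"
    | "isotopic D (plat_closure (replicate (j + 3) False))"
    unfolding same_knot_def mirror unfolding foil_eq_plat_closure by blast
  then show ?thesis
  proof cases
    case 1
    have "odd_part (bracket (plat_closure (replicate (j + 3) True))) (69888 * 16 ^ j - 1)"
      using assms(2) by (intro odd_part_plat_closure(3)) (simp_all only: twist_sum_simps, simp_all)
    then show ?thesis
      using odd_part_isotopic[OF 1 assms(3)] odd_part_unique by blast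
  next
    case 2
    have "odd_part (bracket (plat_closure (replicate (j + 3) False))) (65536 * 16 ^ j - 273)"
      using assms(2) by (intro odd_part_plat_closure(4)) (simp_all only: twist_sum_simps, simp_all)
    then show ?thesis
      using odd_part_isotopic[OF 2 assms(3)] odd_part_unique by blast
  qed
qed

lemma odd_int_cases:
  assumes "odd (w :: int)"
  obtains "w = 1" | "w = - 1" | m where "w = int m + 3" "even m" | m where "w = - int m - 3" "even m"
proof -
  have "w = 1 \<or> w = - 1 \<or> w \<ge> 3 \<or> w \<le> - 3"
    using assms by presburger
  then consider "w = 1" | "w = - 1" | "w \<ge> 3" | "w \<le> - 3"
    by blast
  then show ?thesis
  proof cases
    case 3
    then show ?thesis
      using assms that(3)[of "nat (w - 3)"] by (simp add: even_nat_iff)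
  next
    case 4
    then show ?thesis
      using assms that(4)[of "nat (- w - 3)"] by (simp add: even_nat_iff)
  qed (use that in auto)
qed

text \<open>The odd parts for \<open>w \<ge> 3\<close> and for \<open>w \<le> - 3\<close> form two
  disjoint injective families that avoid 17, so they determine the absolute value of the signed
  count \<open>w\<close>.\<close>

lemma same_knot_plat_closure_foil:
  assumes "odd (twist_sum cs)" "odd k" "3 \<le> k"
  shows "same_knot (plat_closure cs) (foil k) \<longleftrightarrow> \<bar>twist_sum cs\<bar> = int k"
proof
  assume "\<bar>twist_sum cs\<bar> = int k"
  then have "k = (if twist_sum cs \<ge> 0 then nat (twist_sum cs) else nat (- twist_sum cs))"
    by (smt (verit) nat_int)
  then show "same_knot (plat_closure cs) (foil k)"
    using plat_closure_isotopic_foil[of cs] unfolding same_knot_def by metis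
next
  assume same: "same_knot (plat_closure cs) (foil k)"
  obtain j where j: "k = j + 3" "even j"
    using assms(2,3) by (rule odd_nat_ge_3E)
  note cases = foil_odd_part_cases[OF same[unfolded j(1)] j(2)]
  from assms(1) show "\<bar>twist_sum cs\<bar> = int k"
  proof (cases rule: odd_int_cases)
    case 1
    then show ?thesis
      using cases[OF odd_part_plat_closure(1)[OF 1]] odd_parts_disjoint(6,7)[OF refl refl, of j] by blast
  next
    case 2
    then show ?thesis
      using cases[OF odd_part_plat_closure(2)[OF 2]] odd_parts_disjoint(6,7)[OF refl refl, of j] by blast
  next
    case (3 m)
    have "69888 * (16 :: int) ^ m - 1 = 69888 * 16 ^ j - 1"
      using cases[OF odd_part_plat_closure(3)[OF 3]] odd_parts_disjoint(1)[OF refl refl, of m j]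
      by metis
    then have "m = j"
      by simp
    then show ?thesis
      unfolding 3(1) j(1) by simp
  next
    case (4 m)
    have "65536 * (16 :: int) ^ m - 273 = 65536 * 16 ^ j - 273"
      using cases[OF odd_part_plat_closure(4)[OF 4]] odd_parts_disjoint(1)[OF refl refl, of j m]
      by metis
    then have "m = j"
      by simp
    then show ?thesis
      unfolding 4(1) j(1) by simp
  qed
qed

text \<open>No odd part of this family of clasps is the odd part of a foil with at least three
  crossings.\<close>

lemma not_same_knot_alternating_clasp_closure_foil:
  assumes "odd (twist_sum cs)" "odd k" "3 \<le> k"
  shows "\<not> same_knot (clasp_closure True True False cs) (foil k)"
proof
  assume same: "same_knot (clasp_closure True True False cs) (foil k)"
  obtain j where j: "k = j + 3" "even j"
    using assms(2,3) by (rule odd_nat_ge_3E)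
  note cases = foil_odd_part_cases[OF same[unfolded j(1)] j(2)]
  note disjoint = odd_parts_disjoint[OF refl refl]
  from assms(1) show False
  proof (cases rule: odd_int_cases)
    case 1
    then show ?thesis
      using cases[OF odd_part_clasp_closure(1)[OF 1]] disjoint(6,7)[of j] by blast
  next
    case 2
    \<comment> \<open>The negative family of clasps starts at - 1, so this is its member
      \<open>m = 0\<close>; values from - 3 on correspond to \<open>m + 2\<close>.\<close>
    then have "twist_sum cs = - int 0 - 1" "even (0 :: nat)"
      by simp_all
    from cases[OF odd_part_clasp_closure(3)[OF this]] show ?thesis
      using disjoint(4,5)[of 0 j] by blast
  next
    case (3 m)
    then show ?thesis
      using cases[OF odd_part_clasp_closure(2)[OF 3]] disjoint(2,3)[of m j] by blast
  next
    case (4 m)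
    then have "twist_sum cs = - int (m + 2) - 1" "even (m + 2)"
      by simp_all
    from cases[OF odd_part_clasp_closure(3)[OF this]] show ?thesis
      using disjoint(4,5)[of "m + 2" j] by blast
  qed
qed

lemma same_knot_clasp_closure_foil:
  assumes "odd (twist_sum cs)" "odd k" "3 \<le> k"
  shows "same_knot (clasp_closure l r b cs) (foil k) \<longleftrightarrow>
    (if l \<noteq> r then \<bar>twist_sum cs\<bar> = int k
     else l = b \<and> \<bar>twist_sum cs + (if b then 2 else - 2)\<bar> = int k)"
proof -
  consider "l \<noteq> r" | "l = b" "r = b" | "l = True" "r = True" "b = False" | "l = False" "r = False" "b = True"
    by (cases l; cases r; cases b) auto
  then show ?thesis
  proof cases
    case 1
    then show ?thesis
      unfolding same_knot_cong[OF clasp_closure_isotopic_unclasp[OF 1]] same_knot_plat_closure_foil[OF assms]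
      by simp
  next
    case 2
    have "odd (twist_sum (b # b # cs))"
      using assms(1) by simp
    then have "same_knot (clasp_closure b b b cs) (foil k) \<longleftrightarrow> \<bar>twist_sum (b # b # cs)\<bar> = int k"
      unfolding same_knot_cong[OF clasp_closure_isotopic_reduced]
      by (rule same_knot_plat_closure_foil[OF _ assms(2,3)])
    moreover have "twist_sum (b # b # cs) = twist_sum cs + (if b then 2 else - 2)"
      by simp
    ultimately show ?thesis
      unfolding 2 by (simp only: refl if_True if_False not_True_eq_False simp_thms)
  next
    case 3
    show ?thesis
      unfolding 3 using not_same_knot_alternating_clasp_closure_foil[OF assms] by simp
  next
    case 4
    \<comment> \<open>The mirror image has \<open>B\<close> = \<open>False\<close> and the other two
      \<open>True\<close>, and its row still has an odd signed count.\<close>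
    have "twist_sum (map Not cs) = - twist_sum cs"
      by (induction cs) simp_all
    then have "\<not> same_knot (clasp_closure True True False (map Not cs)) (foil k)"
      using not_same_knot_alternating_clasp_closure_foil[of "map Not cs"] assms by simp
    moreover have "clasp_closure True True False (map Not cs) = mirror (clasp_closure l r b cs)"
      unfolding 4 by (simp add: clasp_closure_def)
    ultimately show ?thesis
      unfolding 4 by (simp add: same_knot_mirror)
  qed
qed

section \<open>Counting the assignments\<close>

lemma card_subsets_eq_binom:
  assumes "finite A"
  shows "card {S. S \<subseteq> A \<and> int (card S) = z} = binom (card A) z"
proof (cases "z < 0")
  case False
  then have "{S. S \<subseteq> A \<and> int (card S) = z} = {S. S \<subseteq> A \<and> card S = nat z}"
    by auto
  with False show ?thesis
    using n_subsets[OF assms] by (simp add: binom_def)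
qed (simp add: binom_def)

lemma binom_symmetric: "binom n z = binom n (int n - z)"
proof -
  consider "z < 0" | "z > int n" | m where "z = int m" "m \<le> n"
    by (metis linorder_not_less nonneg_int_cases of_nat_le_iff)
  then show ?thesis
  proof cases
    case 3
    then show ?thesis
      using binomial_symmetric[of m n] by (simp add: binom_def nat_diff_distrib)
  qed (auto simp: binom_def binomial_eq_0)
qed

text \<open>\<open>S\<close> holds the row crossings labelled \<open>True\<close>, and
  \<open>c\<close> is the contribution of the upper crossings. The absolute value gives two
  equations for \<open>card S\<close>, solvable in integers by parity.\<close>

lemma card_subsets_twist:
  assumes "odd n" "odd k" "even c"
  shows "card {S. S \<subseteq> {..<n} \<and> \<bar>2 * int (card S) - int n + c\<bar> = int k} =
    binom n ((int n - int k + c) div 2) + binom n ((int n - int k - c) div 2)"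
proof -
  have "2 * ((int n - c + int k) div 2) = int n - c + int k" "2 * ((int n - c - int k) div 2) = int n - c - int k"
    using assms by simp_all
  then have "{S. S \<subseteq> {..<n} \<and> \<bar>2 * int (card S) - int n + c\<bar> = int k} =
      {S. S \<subseteq> {..<n} \<and> int (card S) = (int n - c + int k) div 2} \<union>
      {S. S \<subseteq> {..<n} \<and> int (card S) = (int n - c - int k) div 2}"
    by auto
  also have "card \<dots> = binom n ((int n - c + int k) div 2) + binom n ((int n - c - int k) div 2)"
  proof -
    \<comment> \<open>This makes the two solutions for \<open>card S\<close> different.\<close>
    have "k > 0"
      using assms(2) by (cases k) auto
    then show ?thesis
      using assms card_subsets_eq_binom[of "{..<n}"] by (subst card_Un_disjoint) auto
  qed
  also have "binom n ((int n - c + int k) div 2) = binom n ((int n - int k + c) div 2)"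
    by (subst binom_symmetric) (rule arg_cong[where f = "binom n"], use assms in presburger)
  finally show ?thesis
    by (simp add: algebra_simps)
qed

lemma twist_sum_map_row: "twist_sum (map p [0..<n]) = 2 * int (card {j. j < n \<and> p j}) - int n"
proof (induction n)
  case (Suc n)
  have "{j. j < Suc n \<and> p j} = (if p n then insert n {j. j < n \<and> p j} else {j. j < n \<and> p j})"
    by (auto simp: less_Suc_eq)
  with Suc show ?case
    by (simp add: twist_sum_def)
qed simp

lemma bij_betw_assignments_free_21n:
  "bij_betw (\<lambda>s. (s L, s R, s B, {j. j < n \<and> s (Row j)})) (assignments (free_21n n))
     (UNIV \<times> UNIV \<times> UNIV \<times> Pow {..<n})"
proof -
  have "crossings (free_21n n) = {L, R, B} \<union> Row ` {0..<n}"
    by (auto simp: crossings_def free_21n_def)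
  then have "assignments (free_21n n) = ({L, R, B} \<union> Row ` {..<n}) \<rightarrow>\<^sub>E UNIV"
    by (simp add: assignments_def atLeast0LessThan)
  moreover have "bij_betw (\<lambda>s. (s L, s R, s B, {j. j < n \<and> s (Row j)})) (({L, R, B} \<union> Row ` {..<n}) \<rightarrow>\<^sub>E UNIV)
     (UNIV \<times> UNIV \<times> UNIV \<times> Pow {..<n})"
  \<comment> \<open>The inverse must return \<open>undefined\<close> off the crossings of the
    diagram, as \<open>\<rightarrow>\<^sub>E\<close> demands.\<close>
  proof (rule bij_betw_byWitness[where f' = "\<lambda>(l, r, b, S). \<lambda>c. case c of L \<Rightarrow> l | R \<Rightarrow> r | B \<Rightarrow> b
      | Row j \<Rightarrow> if j < n then j \<in> S else undefined"])
    show "(\<lambda>(l, r, b, S). \<lambda>c. case c of L \<Rightarrow> l | R \<Rightarrow> r | B \<Rightarrow> b | Row j \<Rightarrow> if j < n then j \<in> S else undefined)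
        ` (UNIV \<times> UNIV \<times> UNIV \<times> Pow {..<n}) \<subseteq> ({L, R, B} \<union> Row ` {..<n}) \<rightarrow>\<^sub>E UNIV"
    proof (clarify, rule PiE_I)
      fix l r b :: bool and S :: "nat set" and x
      assume "x \<notin> {L, R, B} \<union> Row ` {..<n}"
      then show "(case x of L \<Rightarrow> l | R \<Rightarrow> r | B \<Rightarrow> b | Row j \<Rightarrow> if j < n then j \<in> S else undefined) = undefined"
        by (cases x) auto
    qed simp
  qed (auto simp: PiE_def extensional_def fun_eq_iff split: crossing_name.splits)
  ultimately show ?thesis
    by simp
qed

lemma num_producing_foil:
  assumes "odd n" "odd k" "3 \<le> k"
  shows "num_producing n (foil k) =
    8 * binom n ((int n - int k) div 2)
    + 2 * binom n ((int n - int k + 2) div 2)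
    + 2 * binom n ((int n - int k - 2) div 2)"
proof -
  define N where "N c = {S. S \<subseteq> {..<n} \<and> \<bar>2 * int (card S) - int n + c\<bar> = int k}" for c
  define good where "good l r b = (if l \<noteq> r then N 0 else if l = b then N (if b then 2 else - 2) else {})"
    for l r b :: bool
  let ?h = "\<lambda>s. (s L, s R, s B, {j. j < n \<and> s (Row j)})"
  have same: "same_knot (assign s (free_21n n)) (foil k) \<longleftrightarrow> {j. j < n \<and> s (Row j)} \<in> good (s L) (s R) (s B)" for s
  proof -
    have "odd (twist_sum (map (\<lambda>j. s (Row j)) [0..<n]))"
      using assms(1) by (simp add: twist_sum_map_row)
    then show ?thesis
      unfolding assign_free_21n using assms(2,3)
      by (subst same_knot_clasp_closure_foil) (auto simp: twist_sum_map_row good_def N_def)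
  qed
  have fin: "finite (N c)" for c
    unfolding N_def by (rule finite_subset[of _ "Pow {..<n}"]) auto
  then have fin_good: "finite (good l r b)" for l r b
    by (simp add: good_def)
  have sub: "good l r b \<subseteq> Pow {..<n}" for l r b
    by (auto simp: good_def N_def split: if_splits)
  have "num_producing n (foil k) = card {s \<in> assignments (free_21n n). {j. j < n \<and> s (Row j)} \<in> good (s L) (s R) (s B)}"
    by (simp add: num_producing_def same)
  also have "\<dots> = card (SIGMA l:UNIV. SIGMA r:UNIV. SIGMA b:UNIV. good l r b)"
  proof (rule bij_betw_same_card)
    have img: "?h ` {s \<in> assignments (free_21n n). {j. j < n \<and> s (Row j)} \<in> good (s L) (s R) (s B)} =
        (SIGMA l:UNIV. SIGMA r:UNIV. SIGMA b:UNIV. good l r b)" (is "?h ` ?A = ?B")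
    proof
      show "?B \<subseteq> ?h ` ?A"
      proof
        fix x assume x: "x \<in> ?B"
        then have "x \<in> UNIV \<times> UNIV \<times> UNIV \<times> Pow {..<n}"
          using sub by fastforce
        then obtain s where "s \<in> assignments (free_21n n)" "x = ?h s"
          using bij_betw_imp_surj_on[OF bij_betw_assignments_free_21n[of n]] by blast
        with x show "x \<in> ?h ` ?A"
          by auto
      qed
    qed auto
    have "inj_on ?h ?A"
      by (rule inj_on_subset[OF bij_betw_imp_inj_on[OF bij_betw_assignments_free_21n]]) auto
    with img show "bij_betw ?h ?A ?B"
      by (simp add: bij_betw_def)
  qed
  also have "\<dots> = (\<Sum>l\<in>UNIV. \<Sum>r\<in>UNIV. \<Sum>b\<in>UNIV. card (good l r b))"
    using fin_good by (simp add: card_SigmaI)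
  \<comment> \<open>Of the eight triples of labels, four have \<open>l \<noteq> r\<close>, two have
    all labels equal, and two contribute nothing.\<close>
  also have "\<dots> = 4 * card (N 0) + card (N 2) + card (N (- 2))"
    by (simp add: UNIV_bool good_def)
  \<comment> \<open>\<open>N 0\<close> gives the middle binomial coefficient twice;
    \<open>N 2\<close> and \<open>N (- 2)\<close> each give the sum of the two others.\<close>
  also have "\<dots> = 8 * binom n ((int n - int k) div 2)
    + 2 * binom n ((int n - int k + 2) div 2)
    + 2 * binom n ((int n - int k - 2) div 2)"
    using card_subsets_twist[OF assms(1,2), of 0] card_subsets_twist[OF assms(1,2), of 2]
      card_subsets_twist[OF assms(1,2), of "- 2"] by (simp add: N_def)
  finally show ?thesis .
qed

theorem theorem6p3:
  fixes n :: nat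
  assumes "odd n"
  shows "num_producing n (foil 3) =
           8 * binom n ((int n - 3) div 2)
           + 2 * binom n ((int n - 1) div 2)
           + 2 * binom n ((int n - 5) div 2)
    \<and> (\<forall>k::nat. odd k \<and> 3 \<le> k \<and> k \<le> n \<longrightarrow>
           num_producing n (foil k) =
             8 * binom n ((int n - int k) div 2)
             + 2 * binom n ((int n - int k + 2) div 2)
             + 2 * binom n ((int n - int k - 2) div 2))"
  using num_producing_foil[OF assms] num_producing_foil[OF assms, of 3] by (simp add: algebra_simps)

end
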